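(* Let $f\in\mathbb{Z}[X]$ be a monic irreducible polynomial of degree $d\geq 2$ which is even, i.e. $f(-X)=f(X)$. For integers $N\geq1$ put $\ell_f(N)=\operatorname{rad}\operatorname{lcm}\{f(1),\ldots,f(N)\}$ (equivalently, the product of the distinct primes dividing $f(1)f(2)\cdots f(N)$). Then there is a constant $C>0$ depending only on $f$ such that for all integers $N\geq 2$, \[ \log \ell_f(N)\;\geq\;\frac{8(d-1)}{d(3d-2)}\,N\log N - C N . \]
   Context: $\operatorname{rad}(m)$ denotes the product of the distinct primes dividing the nonzero integer $m$. *)

theory Defs
  imports Complex_Main "HOL-Computational_Algebra.Computational_Algebra"
begin

text \<open>Over \<^typ>\<open>int\<close>, \<^term>\<open>prime_factors m\<close> contains only the positive primes; the value at
  \<open>m = 0\<close> is the irrelevant default \<open>1\<close>.\<close>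
definition rad :: "int \<Rightarrow> int" where
  "rad m = (\<Prod>p\<in>prime_factors m. p)"

definition ell :: "int poly \<Rightarrow> nat \<Rightarrow> int" where
  "ell f N = rad (Lcm ((\<lambda>n. poly f (int n)) ` {1..N}))"

definition even_poly :: "int poly \<Rightarrow> bool" where
  "even_poly f \<longleftrightarrow> pcompose f [:0, -1:] = f"

end

theory Submission
  imports Defs "HOL-Analysis.Convex" "HOL-Analysis.Summation_Tests" "Jordan_Normal_Form.Determinant"
begin

hide_const (open) Module.smult

text \<open>
  Factor \<open>\<bar>f(1) \<cdots> f(N)\<bar>\<close>, whose logarithm is \<open>d N ln N + O(N)\<close>, and compare the contributions of the primes
  below and above \<open>B N\<close>, where \<open>B\<close> is a large constant.

  For \<open>p > B N\<close> let \<open>S\<^sub>k\<close> be the set of \<open>n \<le> N\<close> with \<open>p\<^sup>k\<close> dividing \<open>f(n)\<close>. As \<open>f\<close> is even, \<open>n\<close> and \<open>-n\<close>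
  are distinct roots modulo \<open>p\<close>, so \<open>S\<^sub>k\<close> has at most \<open>d/2\<close> elements. Moreover \<open>p\<^sup>k\<close> divides the divided difference of \<open>f\<close>
  at the \<open>j\<close> points of \<open>S\<^sub>k\<close>, a positive integer of size \<open>O(N\<^bsup>d - j + 1\<^esup>)\<close>, whence \<open>j \<le> d - k\<close>.
  Summing over \<open>k\<close>, the multiplicity of \<open>p\<close> in the product is at most \<open>d (3 d - 2) / 8\<close>.

  The primes \<open>p \<le> B N\<close> contribute at most \<open>N ln N + O(N)\<close> by the Mertens-type estimate
  \<open>\<Sum>p\<le>x. \<rho>(p) ln p / p \<le> ln x + O(1)\<close>, where \<open>\<rho>(p)\<close> counts the roots of \<open>f\<close> modulo \<open>p\<close>.
  No ideal theory is needed for it: take the \<open>n = A\<^sup>d\<close> polynomials of degree below \<open>d\<close> with coefficients in \<open>[0, A)\<close>.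
  Norms from \<open>\<int>[x]/(f)\<close> of their differences are \<open>O(A\<^sup>d)\<close>, and such a norm is divisible by \<open>p\<close> to the number
  of roots modulo \<open>p\<close> shared with \<open>f\<close>. For each root of \<open>f\<close> modulo \<open>p\<close>, at least \<open>n\<^sup>2/p - n\<close> of the ordered pairs of
  distinct polynomials agree there by the Cauchy-Schwarz inequality. Multiplying all these norms gives the estimate.
\<close>

section \<open>Divided differences modulo prime powers\<close>

lemma poly_synthetic_div:
  fixes q :: "'a::comm_ring_1 poly"
  shows "poly q z = poly q y + (z - y) * poly (synthetic_div q y) z"
proof -
  have "poly ([:-y, 1:] * synthetic_div q y + [:poly q y:]) z = poly q z"
    by (simp only: synthetic_div_correct')
  then show ?thesis by (simp add: algebra_simps)
qed

lemma monic_synthetic_div: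
  fixes q :: "'a::idom poly"
  assumes "lead_coeff q = 1" "degree q > 0"
  shows "lead_coeff (synthetic_div q y) = 1"
proof -
  have 0: "degree (synthetic_div q y) = degree q - 1" by (rule degree_synthetic_div)
  have "q = [:-y, 1:] * synthetic_div q y + [:poly q y:]" by (simp only: synthetic_div_correct')
  then have "coeff q (degree q) = coeff ([:-y, 1:] * synthetic_div q y + [:poly q y:]) (degree q)"
    by (rule arg_cong)
  also have "\<dots> = coeff (synthetic_div q y) (degree q - 1)"
    using assms(2) 0 by (cases "degree q") (auto simp: coeff_eq_0)
  finally show ?thesis using assms 0 by simp
qed

text \<open>The factor \<open>z - y\<close> is a unit modulo p^k, so it cancels from q(z) - q(y).
  This keeps divisibility by p^k alive while divided differences are iterated.\<close>

lemma synthetic_div_dvd: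
  fixes q :: "int poly"
  assumes "prime p" "p ^ k dvd poly q y" "p ^ k dvd poly q z" "\<not> p dvd z - y"
  shows "p ^ k dvd poly (synthetic_div q y) z"
proof -
  have "p ^ k dvd (z - y) * poly (synthetic_div q y) z"
    using dvd_diff[OF assms(3,2)] poly_synthetic_div[of q z y] by simp
  moreover have "coprime (p ^ k) (z - y)"
    using assms(1,4) by (simp add: prime_imp_coprime)
  ultimately show ?thesis by (simp add: coprime_dvd_mult_right_iff)
qed

text \<open>Lagrange's bound: one root is split off by synthetic division, the others survive in the
  quotient because they differ from it modulo \<open>p\<close>, and the quotient stays
  monic.\<close>

lemma length_roots_mod_prime_le:
  fixes q :: "int poly"
  assumes "prime p" "lead_coeff q = 1"
    and "\<forall>y\<in>set ys. p dvd poly q y" "distinct ys"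
    and "\<forall>y\<in>set ys. \<forall>z\<in>set ys. y \<noteq> z \<longrightarrow> \<not> p dvd z - y"
  shows "length ys \<le> degree q"
  using assms(2-)
proof (induction ys arbitrary: q)
  case (Cons y ys)
  have "degree q > 0"
  proof (rule ccontr)
    assume "\<not> degree q > 0"
    then obtain c where "q = [:c:]" using degree_eq_zeroE by blast
    then show False using Cons.prems(1,2) assms(1) by (auto simp: not_prime_unit)
  qed
  have "length ys \<le> degree (synthetic_div q y)"
  proof (rule Cons.IH)
    show "lead_coeff (synthetic_div q y) = 1"
      using Cons.prems(1) \<open>degree q > 0\<close> by (rule monic_synthetic_div)
    show "\<forall>z\<in>set ys. p dvd poly (synthetic_div q y) z"
    proof
      fix z assume "z \<in> set ys"
      then have "p ^ 1 dvd poly (synthetic_div q y) z"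
        using Cons.prems assms(1) by (intro synthetic_div_dvd) auto
      then show "p dvd poly (synthetic_div q y) z" by simp
    qed
  qed (use Cons.prems in auto)
  then show ?case using \<open>degree q > 0\<close> by (simp add: degree_synthetic_div)
qed simp

lemma card_roots_mod_prime_le:
  fixes q :: "int poly"
  assumes "prime p" "lead_coeff q = 1" "finite Y"
    and "\<And>y. y \<in> Y \<Longrightarrow> p dvd poly q y"
    and "\<And>y z. y \<in> Y \<Longrightarrow> z \<in> Y \<Longrightarrow> y \<noteq> z \<Longrightarrow> \<not> p dvd z - y"
  shows "card Y \<le> degree q"
proof -
  obtain ys where "set ys = Y" "distinct ys" using finite_distinct_list[OF assms(3)] by blast
  then show ?thesis
    using length_roots_mod_prime_le[OF assms(1,2), of ys] assms(4,5) distinct_card[of ys] by auto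
qed

section \<open>Size of divided differences for nonnegative coefficients\<close>

lemma synthetic_div_nonneg:
  fixes q :: "int poly"
  assumes "\<And>i. coeff q i \<ge> 0" "y \<ge> 0"
  shows "coeff (synthetic_div q y) i \<ge> 0"
  using assms(1)
proof (induction q arbitrary: i)
  case (pCons a q)
  have q: "coeff q i \<ge> 0" for i using pCons.prems[of "Suc i"] by simp
  then have "poly q y \<ge> 0" using assms(2) by (simp add: poly_altdef sum_nonneg)
  then show ?case using pCons.IH[OF q] by (simp add: coeff_pCons split: nat.split)
qed simp

lemma poly_mono_nonneg:
  fixes q :: "int poly"
  assumes "\<And>i. coeff q i \<ge> 0" "0 \<le> y" "y \<le> z"
  shows "poly q y \<le> poly q z"
  using assms by (auto simp: poly_altdef intro!: sum_mono mult_left_mono power_mono)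

text \<open>The quotient of X^n by X - y is the sum of y^i X^(n-1-i), which is at most n N^(n-1) at
  \<open>N\<close>; nonnegative coefficients let these bounds add up. The induction organizes this
  along Horner's scheme.\<close>

lemma poly_synthetic_div_le:
  fixes q :: "int poly"
  assumes "\<And>i. coeff q i \<ge> 0" "0 \<le> y" "y \<le> N"
  shows "N * poly (synthetic_div q y) N \<le> int (degree q) * poly q N"
  using assms(1)
proof (induction q)
  case (pCons a q)
  have q: "coeff q i \<ge> 0" for i using pCons.prems[of "Suc i"] by simp
  have a: "a \<ge> 0" using pCons.prems[of 0] by simp
  show ?case
  proof (cases "q = 0")
    case False
    have "N * (N * poly (synthetic_div q y) N) \<le> N * (int (degree q) * poly q N)"
      using pCons.IH[OF q] assms by (intro mult_left_mono) auto
    moreover have "N * poly q y \<le> N * poly q N"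
      using assms q by (intro mult_left_mono poly_mono_nonneg) auto
    moreover have "a * int (degree q) \<ge> 0" using a by simp
    ultimately have "N * poly q y + N * (N * poly (synthetic_div q y) N)
        \<le> a + (N * poly q N + (a * int (degree q) + N * (int (degree q) * poly q N)))"
      using a by linarith
    then show ?thesis using False by (simp add: algebra_simps)
  qed simp
qed simp

lemma poly_ge_1:
  fixes q :: "int poly"
  assumes "\<And>i. coeff q i \<ge> 0" "lead_coeff q = 1" "y \<ge> 1"
  shows "poly q y \<ge> 1"
proof -
  have "1 \<le> coeff q (degree q) * y ^ degree q" using assms by (simp add: one_le_power)
  also have "\<dots> \<le> poly q y"
    unfolding poly_altdef using assms by (intro member_le_sum) auto
  finally show ?thesis .
qed

text \<open>Iterating \<open>synthetic_div\<close> along \<open>ys\<close> and evaluating at the last point yields the divided difference of \<open>q\<close> at \<open>ys\<close>.\<close>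

lemma prime_power_dvd_values_bound:
  fixes q :: "int poly"
  assumes "prime p" "lead_coeff q = 1" "\<And>i. coeff q i \<ge> 0" "ys \<noteq> []"
    and "\<forall>y\<in>set ys. 1 \<le> y \<and> y \<le> N \<and> p ^ k dvd poly q y" "distinct ys"
    and "\<forall>y\<in>set ys. \<forall>z\<in>set ys. y \<noteq> z \<longrightarrow> \<not> p dvd z - y"
    and "length ys \<le> degree q" "degree q \<le> d"
  shows "p ^ k * N ^ (length ys - 1) \<le> int d ^ (length ys - 1) * poly q N"
  using assms(2-)
proof (induction ys arbitrary: q)
  case (Cons y ys)
  show ?case
  proof (cases "ys = []")
    case True
    have "p ^ k \<le> poly q y"
      using Cons.prems(4) poly_ge_1[OF Cons.prems(2,1), of y] by (intro zdvd_imp_le) auto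
    also have "\<dots> \<le> poly q N" using Cons.prems by (intro poly_mono_nonneg) auto
    finally show ?thesis using True by simp
  next
    case False
    let ?q = "synthetic_div q y"
    have d0: "degree q > 0" and N: "N \<ge> 1" using Cons.prems by auto
    have dg: "degree ?q = degree q - 1" by (rule degree_synthetic_div)
    have nn: "coeff ?q i \<ge> 0" for i using Cons.prems by (intro synthetic_div_nonneg) auto
    have "p ^ k * N ^ (length ys - 1) \<le> int d ^ (length ys - 1) * poly ?q N"
    proof (rule Cons.IH)
      show "lead_coeff ?q = 1" using Cons.prems(1) d0 by (rule monic_synthetic_div)
      show "\<forall>z\<in>set ys. 1 \<le> z \<and> z \<le> N \<and> p ^ k dvd poly ?q z"
        using Cons.prems assms(1) by (auto intro!: synthetic_div_dvd)
    qed (use Cons.prems False dg nn in auto)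
    \<comment> \<open>Each further point gains a factor \<open>N\<close> on the left and costs at
      most a factor \<open>d\<close> on the right.\<close>
    then have "N * (p ^ k * N ^ (length ys - 1)) \<le> N * (int d ^ (length ys - 1) * poly ?q N)"
      using N by (intro mult_left_mono) auto
    also have "\<dots> = int d ^ (length ys - 1) * (N * poly ?q N)" by simp
    also have "\<dots> \<le> int d ^ (length ys - 1) * (int (degree q) * poly q N)"
      using Cons.prems by (intro mult_left_mono poly_synthetic_div_le) auto
    also have "\<dots> \<le> int d ^ (length ys - 1) * (int d * poly q N)"
      using Cons.prems N poly_ge_1[OF Cons.prems(2,1) N] by (intro mult_left_mono mult_right_mono) auto
    finally show ?thesis using False by (cases "length ys") (auto simp: algebra_simps)
  qed
qed simp

text \<open>Write f = a + X g. The shift is a + (t + X) g(t + X): for t \<ge> 0 its higher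
  coefficients are nonnegative by induction, and its constant term a + t g(t) is positive once g(t)
  \<ge> 1 and t \<ge> 1 - a. The claim on values is carried along to supply g(t) \<ge> 1.\<close>

lemma shift_nonneg_coeffs:
  fixes f :: "int poly"
  assumes "lead_coeff f > 0"
  shows "\<exists>t0. \<forall>t\<ge>t0. poly f t \<ge> 1 \<and> (\<forall>i. coeff (pcompose f [:t, 1:]) i \<ge> 0)"
  using assms
proof (induction f)
  case (pCons a g)
  show ?case
  proof (cases "g = 0")
    case True
    then show ?thesis using pCons.prems
      by (auto simp: pcompose_pCons coeff_pCons split: nat.split)
  next
    case False
    then have lg: "lead_coeff g > 0" using pCons.prems by simp
    from pCons.IH[OF this] obtain t0 where
      t0: "\<And>t. t \<ge> t0 \<Longrightarrow> poly g t \<ge> 1"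
          "\<And>t i. t \<ge> t0 \<Longrightarrow> coeff (pcompose g [:t, 1:]) i \<ge> 0" by blast
    define t1 where "t1 = max (max t0 0) (1 - a)"
    have "poly (pCons a g) t \<ge> 1 \<and> (\<forall>i. coeff (pcompose (pCons a g) [:t, 1:]) i \<ge> 0)"
      if t: "t \<ge> t1" for t
    proof -
      have "t * 1 \<le> t * poly g t" using t t0(1)[of t] unfolding t1_def by (intro mult_left_mono) auto
      then have 1: "poly (pCons a g) t \<ge> 1" using t unfolding t1_def by simp
      have "coeff (pcompose (pCons a g) [:t, 1:]) i \<ge> 0" for i
      proof (cases i)
        case 0
        then show ?thesis using 1 by (simp add: poly_pcompose flip: poly_0_coeff_0)
      next
        case (Suc j)
        then show ?thesis using t t0(2)[of t] unfolding t1_def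
          by (auto simp: pcompose_pCons coeff_pCons split: nat.split)
      qed
      then show ?thesis using 1 by blast
    qed
    then show ?thesis by blast
  qed
qed simp

section \<open>Large primes\<close>

text \<open>A multiplicity is the number of exponents k \<ge> 1 with p^k dividing the value;
  exchanging the sums counts level sets instead.\<close>

lemma sum_multiplicity_eq:
  fixes g :: "'b \<Rightarrow> int"
  assumes "finite X" "prime p"
    and "\<And>n. n \<in> X \<Longrightarrow> g n \<noteq> 0 \<and> multiplicity p (g n) \<le> K"
  shows "(\<Sum>n\<in>X. multiplicity p (g n)) = (\<Sum>k=1..K. card {n\<in>X. p ^ k dvd g n})"
proof -
  have nu: "\<not> is_unit p" using assms(2) not_prime_unit by blast
  have "multiplicity p (g n) = (\<Sum>k=1..K. of_bool (p ^ k dvd g n))" if "n \<in> X" for n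
  proof -
    have "{k\<in>{1..K}. p ^ k dvd g n} = {1..multiplicity p (g n)}"
      using assms(3)[OF that] nu by (auto simp: power_dvd_iff_le_multiplicity)
    then show ?thesis by (simp add: sum.If_cases of_bool_def Int_def)
  qed
  then have "(\<Sum>n\<in>X. multiplicity p (g n)) = (\<Sum>n\<in>X. \<Sum>k=1..K. of_bool (p ^ k dvd g n))"
    by simp
  also have "\<dots> = (\<Sum>k=1..K. \<Sum>n\<in>X. of_bool (p ^ k dvd g n))" by (rule sum.swap)
  also have "\<dots> = (\<Sum>k=1..K. card {n\<in>X. p ^ k dvd g n})"
    using assms(1) by (simp add: sum.If_cases of_bool_def Int_def)
  finally show ?thesis .
qed

text \<open>The terms equal \<open>e\<close> up to k = e and then descend through e - 1, ..., 0.
  With d = 2e the sum is d(3d - 2)/8, the source of the constant in the theorem. The form avoids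
  division and truncated subtraction outside the sum.\<close>

lemma sum_min_eq: "2 * (\<Sum>k=1..2*e. min e (2*e - k)) + e = 3 * e * (e::nat)"
proof -
  have "(\<Sum>k=1..2*e. min e (2*e - k)) = (\<Sum>k=1..e. min e (2*e - k)) + (\<Sum>k=e+1..2*e. min e (2*e - k))"
    by (subst sum.union_disjoint[symmetric]) (auto intro!: sum.cong)
  also have "(\<Sum>k=1..e. min e (2*e - k)) = (\<Sum>k=1..e. e)" by (rule sum.cong) auto
  also have "(\<Sum>k=e+1..2*e. min e (2*e - k)) = (\<Sum>i<e. i)"
    by (rule sum.reindex_bij_witness[of _ "\<lambda>i. 2*e - i" "\<lambda>k. 2*e - k"]) auto
  finally have 1: "(\<Sum>k=1..2*e. min e (2*e - k)) = e * e + (\<Sum>i<e. i)" by simp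
  have "2 * (\<Sum>i<e. i) + e = e * e" by (induction e) auto
  then show ?thesis using 1 by (simp add: algebra_simps)
qed

lemma even_poly_eval: "even_poly f \<Longrightarrow> poly f (- x) = poly f x"
proof -
  assume "even_poly f"
  then have "poly (pcompose f [:0, -1:]) x = poly f x" by (simp only: even_poly_def)
  then show ?thesis by (simp add: poly_pcompose)
qed

lemma even_poly_degree:
  assumes "even_poly f" "f \<noteq> 0"
  shows "even (degree f)"
proof -
  have "lead_coeff (pcompose f [:0, -1:]) = lead_coeff f * (-1) ^ degree f"
    by (subst lead_coeff_comp) auto
  then have "lead_coeff f = lead_coeff f * (-1) ^ degree f" using assms(1) by (simp only: even_poly_def)
  then show ?thesis using assms(2) by (cases "even (degree f)") auto
qed

text \<open>The integers n and -n with n in the set are pairwise incongruent roots, since their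
  differences are at most 2N < p in absolute value.\<close>

lemma large_prime_card:
  fixes f :: "int poly"
  assumes "lead_coeff f = 1" "even_poly f" "prime p" "p > 2 * int N"
  shows "2 * card {n\<in>{1..N}. p dvd poly f (int n)} \<le> degree f"
proof -
  let ?S = "{n\<in>{1..N}. p dvd poly f (int n)}"
  let ?Y = "int ` ?S \<union> (\<lambda>n. - int n) ` ?S"
  have "card ?Y = card (int ` ?S) + card ((\<lambda>n. - int n) ` ?S)"
    by (intro card_Un_disjoint) auto
  also have "\<dots> = 2 * card ?S" by (simp add: card_image inj_on_def)
  finally have "2 * card ?S = card ?Y" by simp
  also have "\<dots> \<le> degree f"
  proof (rule card_roots_mod_prime_le[OF assms(3,1)])
    fix y z assume "y \<in> ?Y" "z \<in> ?Y" "y \<noteq> z"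
    then have "z - y \<noteq> 0" "\<bar>z - y\<bar> < p" using assms(4) by auto
    then show "\<not> p dvd z - y" using dvd_imp_le_int[of "z - y" p] by auto
  qed (use assms(2) in \<open>auto simp: even_poly_eval\<close>)
  finally show ?thesis .
qed

lemma poly_le_power:
  fixes q :: "int poly"
  assumes "\<And>i. coeff q i \<ge> 0" "N \<ge> 1"
  shows "poly q N \<le> poly q 1 * N ^ degree q"
proof -
  have "poly q N \<le> (\<Sum>i\<le>degree q. coeff q i * N ^ degree q)"
    unfolding poly_altdef using assms by (intro sum_mono mult_left_mono power_increasing) auto
  then show ?thesis by (simp add: poly_altdef sum_distrib_right)
qed

text \<open>Replacing \<open>f(x)\<close> by \<open>f(x + t)\<close> makes all coefficients nonnegative, so that no divided difference at positive points vanishes.\<close>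

lemma large_prime_power_card:
  fixes f :: "int poly"
  assumes "lead_coeff f = 1" "\<And>n. poly f (int n) \<noteq> 0" "degree f = d"
  shows "\<exists>B\<ge>2. \<forall>N\<ge>1. \<forall>p k. prime p \<longrightarrow> p > B * int N \<longrightarrow> k \<ge> 1 \<longrightarrow>
    {n\<in>{1..N}. p ^ k dvd poly f (int n)} \<noteq> {} \<longrightarrow>
    card {n\<in>{1..N}. p ^ k dvd poly f (int n)} \<le> d \<longrightarrow>
    k + card {n\<in>{1..N}. p ^ k dvd poly f (int n)} \<le> d"
proof -
  obtain t0 where t0: "\<And>t i. t \<ge> t0 \<Longrightarrow> coeff (pcompose f [:t, 1:]) i \<ge> 0"
    using shift_nonneg_coeffs[of f] assms(1) by auto
  define t where "t = nat t0"
  define g where "g = pcompose f [:int t, 1:]"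
  have g0: "coeff g i \<ge> 0" for i unfolding g_def t_def by (rule t0) auto
  have dg: "degree g = d" unfolding g_def using assms(3) by (simp add: degree_pcompose)
  have lg: "lead_coeff g = 1" unfolding g_def using assms(1) by (subst lead_coeff_comp) auto
  have pg: "poly g y = poly f (int t + y)" for y unfolding g_def by (simp add: poly_pcompose)
  define c where "c = poly g 1"
  have c1: "c \<ge> 1" unfolding c_def by (rule poly_ge_1[OF g0 lg]) auto
  \<comment> \<open>A point n \<le> t would become a nonpositive argument of \<open>g\<close>.
    Primes above \<open>M\<close> cannot divide the nonzero value f(n) there, so such points drop
    out.\<close>
  define M where "M = (\<Sum>n\<in>{1..t}. \<bar>poly f (int n)\<bar>)"
  define B where "B = 2 + int d ^ d * c + M"
  have M0: "M \<ge> 0" unfolding M_def by (auto intro: sum_nonneg)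
  have B: "B \<ge> 2" "B \<ge> int d ^ d * c" "B > M" unfolding B_def using c1 M0 by (auto intro: add_pos_nonneg)
  show ?thesis
  proof (intro exI[of _ B] conjI B(1) allI impI)
    fix N :: nat and p :: int and k :: nat
    let ?S = "{n\<in>{1..N}. p ^ k dvd poly f (int n)}"
    assume N: "N \<ge> 1" and p: "prime p" "p > B * int N" and k: "k \<ge> 1"
      and ne: "?S \<noteq> {}" and cd: "card ?S \<le> d"
    have BN: "B * 1 \<le> B * int N" using N B(1) by (intro mult_left_mono) auto
    then have pB: "p > B" using p(2) by simp
    have NB: "1 * int N \<le> B * int N" using B(1) by (intro mult_right_mono) auto
    have gt: "n > t" if "n \<in> ?S" for n
    proof (rule ccontr)
      assume "\<not> n > t"
      then have "\<bar>poly f (int n)\<bar> \<le> M" unfolding M_def using that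
        by (intro member_le_sum) auto
      moreover have "p dvd poly f (int n)" using that k
        by (metis (mono_tags, lifting) dvd_power dvd_trans mem_Collect_eq not_one_le_zero zero_less_iff_neq_zero)
      then have "p \<le> \<bar>poly f (int n)\<bar>" using assms(2)[of n] dvd_imp_le_int[of "poly f (int n)" p] p(1)
        by (simp add: prime_ge_0_int)
      ultimately show False using pB B(3) by linarith
    qed
    define Y where "Y = (\<lambda>n. int n - int t) ` ?S"
    have cY: "card Y = card ?S" unfolding Y_def by (intro card_image) (auto simp: inj_on_def)
    obtain ys where ys: "set ys = Y" "distinct ys"
      using finite_distinct_list[of Y] unfolding Y_def by auto
    have ly: "length ys = card ?S" using ys cY distinct_card[of ys] by simp
    define j where "j = length ys"
    have j: "1 \<le> j" "j \<le> d" using ly ne cd card_gt_0_iff[of ?S] unfolding j_def by auto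
    have main: "p ^ k * int N ^ (j - 1) \<le> int d ^ (j - 1) * poly g (int N)"
      unfolding j_def
    proof (rule prime_power_dvd_values_bound[OF p(1) lg g0])
      show "ys \<noteq> []" using j unfolding j_def by auto
      show "\<forall>y\<in>set ys. 1 \<le> y \<and> y \<le> int N \<and> p ^ k dvd poly g y"
      proof
        fix y assume "y \<in> set ys"
        then obtain n where n: "n \<in> ?S" "y = int n - int t" unfolding ys Y_def by blast
        then show "1 \<le> y \<and> y \<le> int N \<and> p ^ k dvd poly g y" using gt[OF n(1)] by (simp add: pg)
      qed
      show "\<forall>y\<in>set ys. \<forall>z\<in>set ys. y \<noteq> z \<longrightarrow> \<not> p dvd z - y"
      proof (intro ballI impI)
        fix y z assume yz: "y \<in> set ys" "z \<in> set ys" "y \<noteq> z"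
        then have "z - y \<noteq> 0" "\<bar>z - y\<bar> < int N" unfolding ys Y_def by auto
        then show "\<not> p dvd z - y" using dvd_imp_le_int[of "z - y" p] p(2) NB by auto
      qed
      show "distinct ys" by (rule ys)
      show "length ys \<le> degree g" "degree g \<le> d" using dg j unfolding j_def by auto
    qed
    also have "\<dots> \<le> int d ^ d * (c * int N ^ d)"
    proof (rule mult_mono)
      show "int d ^ (j - 1) \<le> int d ^ d" using j by (intro power_increasing) auto
      show "poly g (int N) \<le> c * int N ^ d" using poly_le_power[OF g0, of "int N"] N dg c_def by simp
    qed (use poly_ge_1[OF g0 lg, of "int N"] N in auto)
    also have "\<dots> = (int d ^ d * c) * int N ^ (d - j + 1) * int N ^ (j - 1)"
    proof -
      have "(d - j + 1) + (j - 1) = d" using j by simp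
      then have "int N ^ d = int N ^ (d - j + 1) * int N ^ (j - 1)" by (metis power_add)
      then show ?thesis by simp
    qed
    finally have "p ^ k \<le> (int d ^ d * c) * int N ^ (d - j + 1)" using N by simp
    also have "\<dots> \<le> B * int N ^ (d - j + 1)" using B(2) by (intro mult_right_mono) auto
    \<comment> \<open>Raising \<open>B\<close> to the same power as \<open>N\<close> turns the bound
      into a power of B N, which is comparable with p > B N. The exponent is at least 1 because j
      \<le> d.\<close>
    also have "\<dots> \<le> B ^ (d - j + 1) * int N ^ (d - j + 1)"
      using B(1) self_le_power[of B "d - j + 1"] by (intro mult_right_mono) auto
    also have "\<dots> = (B * int N) ^ (d - j + 1)" by (simp add: power_mult_distrib)
    also have "\<dots> < p ^ (d - j + 1)" using p(2) B(1) by (intro power_strict_mono) auto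
    finally have "p ^ k < p ^ (d - j + 1)" .
    then have "k < d - j + 1" using p(1) prime_gt_1_int power_less_imp_less_exp by blast
    then show "k + card ?S \<le> d" using j ly unfolding j_def by simp
  qed
qed

lemma large_prime_sum_multiplicity:
  fixes f :: "int poly"
  assumes "lead_coeff f = 1" "even_poly f" "\<And>n. poly f (int n) \<noteq> 0" "degree f = d" "d \<ge> 1"
  shows "\<exists>B\<ge>2. \<forall>N\<ge>1. \<forall>p. prime p \<longrightarrow> p > B * int N \<longrightarrow>
    8 * real (\<Sum>n=1..N. multiplicity p (poly f (int n))) \<le> real d * (3 * real d - 2)"
proof -
  obtain B where B: "B \<ge> 2" "\<And>N p k. N \<ge> 1 \<Longrightarrow> prime p \<Longrightarrow> p > B * int N \<Longrightarrow> k \<ge> 1 \<Longrightarrow>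
    {n\<in>{1..N}. p ^ k dvd poly f (int n)} \<noteq> {} \<Longrightarrow>
    card {n\<in>{1..N}. p ^ k dvd poly f (int n)} \<le> d \<Longrightarrow>
    k + card {n\<in>{1..N}. p ^ k dvd poly f (int n)} \<le> d"
    using large_prime_power_card[OF assms(1,3,4)] by blast
  obtain e where e: "d = 2 * e" using even_poly_degree[OF assms(2)] assms(1,4) by fastforce
  show ?thesis
  proof (intro exI[of _ B] conjI B(1) allI impI)
    fix N :: nat and p :: int
    assume N: "N \<ge> 1" and p: "prime p" "p > B * int N"
    let ?S = "\<lambda>k. {n\<in>{1..N}. p ^ k dvd poly f (int n)}"
    have "2 * int N \<le> B * int N" using B(1) by (intro mult_right_mono) auto
    then have c1: "2 * card (?S 1) \<le> d"
      using large_prime_card[OF assms(1,2) p(1), of N] p(2) assms(4) by simp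
    have ce: "card (?S k) \<le> e" if "k \<ge> 1" for k
    proof -
      have "p dvd x" if "p ^ k dvd x" for x
        using dvd_trans[OF dvd_power[of k p] that] \<open>k \<ge> 1\<close> by simp
      then have "card (?S k) \<le> card (?S 1)" by (intro card_mono) auto
      then show ?thesis using c1 e by linarith
    qed
    have cS: "card (?S k) \<le> min e (2 * e - k)" if "k \<ge> 1" for k
      using B(2)[OF N p that] ce[OF that] e by (cases "?S k = {}") (auto simp del: Collect_empty_eq)
    \<comment> \<open>For k > 2e the truncated difference \<open>2 * e - k\<close> is 0, so the
      level set is empty and the sum over \<open>k\<close> may stop at 2e.\<close>
    have m: "multiplicity p (poly f (int n)) \<le> 2 * e" if n: "n \<in> {1..N}" for n
    proof (rule ccontr)
      let ?m = "multiplicity p (poly f (int n))"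
      assume "\<not> ?m \<le> 2 * e"
      then have "card (?S ?m) = 0" using cS[of ?m] assms(5) by auto
      moreover have "n \<in> ?S ?m" using n by (simp add: multiplicity_dvd)
      ultimately show False by auto
    qed
    have "(\<Sum>n=1..N. multiplicity p (poly f (int n))) = (\<Sum>k=1..2*e. card (?S k))"
      using m assms(3) by (intro sum_multiplicity_eq p(1)) auto
    also have "\<dots> \<le> (\<Sum>k=1..2*e. min e (2 * e - k))" using cS by (intro sum_mono) auto
    finally have "2 * (\<Sum>n=1..N. multiplicity p (poly f (int n))) + e \<le> 3 * e * e"
      using sum_min_eq[of e] by linarith
    then have "real (2 * (\<Sum>n=1..N. multiplicity p (poly f (int n))) + e) \<le> real (3 * e * e)"
      by (rule of_nat_mono)
    then show "8 * real (\<Sum>n=1..N. multiplicity p (poly f (int n))) \<le> real d * (3 * real d - 2)"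
      unfolding e by (simp add: algebra_simps)
  qed
qed

section \<open>Chebyshev's upper bounds\<close>

lemma prod_primes_dvd:
  fixes x :: "'a::{factorial_semiring, semiring_gcd}"
  assumes "finite P" "\<And>p. p \<in> P \<Longrightarrow> prime p" "\<And>p. p \<in> P \<Longrightarrow> p ^ e p dvd x"
  shows "(\<Prod>p\<in>P. p ^ e p) dvd x"
  using assms
proof (induction P rule: finite_induct)
  case (insert p P)
  have "coprime (p ^ e p) (\<Prod>q\<in>P. q ^ e q)"
  proof (rule prod_coprime_right)
    fix q assume "q \<in> P"
    then have "coprime p q" using insert.hyps insert.prems by (intro primes_coprime) auto
    then show "coprime (p ^ e p) (q ^ e q)" by simp
  qed
  then show ?case using insert by (auto intro!: divides_mult)
qed simp

text \<open>Erdos's argument: for n = 2m + 1 the primes in (m + 1, n] all divide the binomial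
  coefficient of n over m, which is at most 4^m, and induction covers the primes up to m + 1. An
  even n > 2 is not prime, so it adds no factor.\<close>

lemma prod_primes_le_4_power: "(\<Prod>p | prime p \<and> p \<le> n. p) \<le> (4::nat) ^ n"
proof (induction n rule: less_induct)
  case (less n)
  have fin: "finite {p::nat. prime p \<and> p \<le> n}" for n by simp
  consider "n \<le> 2" | m where "n = 2 * m + 1" "m \<ge> 1" | "even n" "n > 2"
  proof (cases "even n")
    case False
    then obtain m where "n = 2 * m + 1" by (elim oddE)
    then show ?thesis using that(1) that(2)[of m] by (cases "m \<ge> 1") auto
  next
    case True
    then show ?thesis using that(1,3) by (meson not_le)
  qed
  then show ?case
  proof cases
    case 1
    show ?thesis
    proof (cases "n = 2")
      case True
      have "{p::nat. prime p \<and> p \<le> 2} = {2}" by (auto dest: prime_ge_2_nat)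
      then show ?thesis using True by simp
    next
      case False
      then have "{p::nat. prime p \<and> p \<le> n} = {}" using 1 by (auto dest!: prime_ge_2_nat)
      then show ?thesis by (simp only: prod.empty) simp
    qed
  next
    case 3
    then have "{p::nat. prime p \<and> p \<le> n} = {p. prime p \<and> p \<le> n - 1}"
      using prime_odd_nat[of n] by (auto simp: le_less)
    then have "(\<Prod>p | prime p \<and> p \<le> n. p) = (\<Prod>p | prime p \<and> p \<le> n - 1. p)" by (rule arg_cong)
    also have "\<dots> \<le> 4 ^ (n - 1)" using 3 by (intro less) auto
    also have "\<dots> \<le> 4 ^ n" by (intro power_increasing) auto
    finally show ?thesis .
  next
    case 2
    let ?c = "(2 * m + 1) choose m"
    let ?P = "{p::nat. prime p \<and> m + 1 < p \<and> p \<le> n}"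
    have c: "?c \<le> 4 ^ m"
    proof -
      \<comment> \<open>The two equal middle entries of the row sum to at most the whole row, 2 *
        4^m, which gives the factor 2 away.\<close>
      have "?c + ((2 * m + 1) choose (m + 1)) = (\<Sum>k\<in>{m, m+1}. (2 * m + 1) choose k)" by simp
      also have "\<dots> \<le> (\<Sum>k\<le>2 * m + 1. (2 * m + 1) choose k)" by (intro sum_mono2) auto
      also have "\<dots> = 2 * 4 ^ m" by (simp only: choose_row_sum) (simp add: power_mult)
      also have "(2 * m + 1) choose (m + 1) = ?c" by (subst binomial_symmetric) auto
      finally show ?thesis by simp
    qed
    have "(\<Prod>p\<in>?P. p ^ 1) dvd ?c"
    proof (rule prod_primes_dvd[where e = "\<lambda>_. 1"])
      fix p assume p: "p \<in> ?P"
      have eq: "fact m * fact (m + 1) * ?c = fact (2 * m + 1)"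
        using binomial_fact_lemma[of m "2 * m + 1"] by simp
      have "p dvd fact (2 * m + 1)" using p 2 by (subst prime_dvd_fact_iff) auto
      then have "p dvd fact m * fact (m + 1) * ?c" using eq by simp
      moreover have "\<not> p dvd fact m" "\<not> p dvd fact (m + 1)" using p by (auto simp: prime_dvd_fact_iff simp del: fact_Suc)
      ultimately show "p ^ 1 dvd ?c" using p by (auto simp: prime_dvd_mult_iff simp del: fact_Suc)
    qed auto
    then have "(\<Prod>p\<in>?P. p) \<le> ?c" by (intro dvd_imp_le) auto
    then have A: "(\<Prod>p\<in>?P. p) \<le> 4 ^ m" using c by simp
    have B: "(\<Prod>p | prime p \<and> p \<le> m + 1. p) \<le> (4::nat) ^ (m + 1)" using 2 by (intro less) auto
    have "{p::nat. prime p \<and> p \<le> n} = {p. prime p \<and> p \<le> m + 1} \<union> ?P" using 2 by auto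
    then have "(\<Prod>p | prime p \<and> p \<le> n. p) = (\<Prod>p | prime p \<and> p \<le> m + 1. p) * (\<Prod>p\<in>?P. p)"
      by (simp add: prod.union_disjoint[symmetric] disjoint_iff)
    also have "\<dots> \<le> 4 ^ (m + 1) * 4 ^ m" by (rule mult_mono[OF B A]) auto
    also have "\<dots> = 4 ^ n" using 2 by (simp flip: power_add)
    finally show ?thesis .
  qed
qed

lemma int_primes_eq_image: "{p::int. prime p \<and> p \<le> int x} = int ` {p. prime p \<and> p \<le> x}"
proof (intro equalityI subsetI)
  fix p :: int assume p: "p \<in> {p. prime p \<and> p \<le> int x}"
  then have "p = int (nat p)" using prime_ge_0_int by simp
  moreover have "prime (nat p)" using p prime_int_nat_transfer by blast
  ultimately show "p \<in> int ` {p. prime p \<and> p \<le> x}" using p by (auto intro!: image_eqI[of _ _ "nat p"])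
qed auto

lemma finite_int_primes_le [simp]: "finite {p::int. prime p \<and> p \<le> x}"
proof -
  have "{p::int. prime p \<and> p \<le> x} \<subseteq> {0..x}" using prime_ge_0_int by auto
  then show ?thesis using finite_subset by blast
qed

lemma chebyshev_theta: "(\<Sum>p | prime p \<and> p \<le> int x. ln (real_of_int p)) \<le> ln 4 * real x"
proof -
  have "(\<Sum>p | prime p \<and> p \<le> int x. ln (real_of_int p)) = (\<Sum>p | prime p \<and> p \<le> x. ln (real p))"
    unfolding int_primes_eq_image by (subst sum.reindex) auto
  also have "\<dots> = ln (real (\<Prod>p | prime p \<and> p \<le> x. p))"
    by (subst of_nat_prod, subst ln_prod) (auto simp: prime_gt_0_nat)
  also have "\<dots> \<le> ln (real (4 ^ x))"
  proof (subst ln_le_cancel_iff)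
    show "real (\<Prod>p | prime p \<and> p \<le> x. p) \<le> real (4 ^ x)"
      using prod_primes_le_4_power[of x] by (rule of_nat_mono)
    show "0 < real (\<Prod>p | prime p \<and> p \<le> x. p)" by (auto simp: prime_gt_0_nat intro!: prod_pos)
  qed auto
  also have "\<dots> = ln 4 * real x" by (simp add: ln_realpow)
  finally show ?thesis .
qed

text \<open>Split at the square root of \<open>x\<close>: there are few primes below it, and above
  it ln x \<le> 2 ln p reduces the count to the theta bound. The multiplied form also covers x = 1,
  where the logarithm vanishes.\<close>

lemma chebyshev_pi:
  assumes "x \<ge> 1"
  shows "real (card {p::int. prime p \<and> p \<le> int x}) * ln (real x) \<le> (2 * ln 4 + 2) * real x"
proof -
  let ?P = "{p::int. prime p \<and> p \<le> int x}"
  let ?S = "{p\<in>?P. real_of_int p \<le> sqrt (real x)}"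
  have ln: "ln (real x) = 2 * ln (sqrt (real x))" using assms by (simp add: ln_sqrt)
  have lnx: "ln (real x) \<ge> 0" using assms by simp
  have "ln (sqrt (real x)) \<le> sqrt (real x)" using ln_bound[of "sqrt (real x)"] assms by simp
  then have l1: "sqrt (real x) * ln (real x) \<le> 2 * real x"
    using mult_left_mono[of "ln (sqrt (real x))" "sqrt (real x)" "sqrt (real x)"] ln by simp
  have "?S \<subseteq> {1..\<lfloor>sqrt (real x)\<rfloor>}" using prime_ge_1_int by (auto simp: le_floor_iff)
  then have "card ?S \<le> card {1..\<lfloor>sqrt (real x)\<rfloor>}" by (intro card_mono) auto
  then have "real (card ?S) \<le> sqrt (real x)" by (simp add: le_nat_iff le_floor_iff)
  then have "real (card ?S) * ln (real x) \<le> sqrt (real x) * ln (real x)" using lnx by (rule mult_right_mono)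
  then have A: "real (card ?S) * ln (real x) \<le> 2 * real x" using l1 by linarith
  have "real (card (?P - ?S)) * ln (real x) = (\<Sum>p\<in>?P - ?S. ln (real x))" by simp
  also have "\<dots> \<le> (\<Sum>p\<in>?P - ?S. 2 * ln (real_of_int p))"
    unfolding ln using assms by (intro sum_mono) (auto simp: prime_gt_0_int)
  also have "\<dots> \<le> (\<Sum>p\<in>?P. 2 * ln (real_of_int p))"
    by (intro sum_mono2) (auto dest: prime_ge_1_int)
  also have "\<dots> \<le> 2 * (ln 4 * real x)" unfolding sum_distrib_left[symmetric] by (intro mult_left_mono chebyshev_theta) auto
  finally have B: "real (card (?P - ?S)) * ln (real x) \<le> 2 * (ln 4 * real x)" .
  have "card ?P = card ?S + card (?P - ?S)"
    using card_Diff_subset[of ?S ?P] card_mono[of ?P ?S] finite_subset[of ?S ?P] by fastforce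
  then have "real (card ?P) * ln (real x) = real (card ?S) * ln (real x) + real (card (?P - ?S)) * ln (real x)"
    by (simp add: algebra_simps)
  then show ?thesis using A B by (simp add: algebra_simps)
qed

section \<open>Norms from the quotient by a monic polynomial\<close>

text \<open>For monic \<open>f\<close> of positive degree this is the remainder of X^n modulo
  \<open>f\<close>: multiply by X and cancel the coefficient in degree \<open>degree f\<close>.
  Because \<open>f\<close> is monic, everything stays integral.\<close>

primrec xrem :: "int poly \<Rightarrow> nat \<Rightarrow> int poly" where
  "xrem f 0 = 1"
| "xrem f (Suc n) = pCons 0 (xrem f n) - smult (coeff (pCons 0 (xrem f n)) (degree f)) f"

text \<open>Remainder modulo a monic \<open>f\<close>, extended linearly from powers of X so that
  additivity is immediate.\<close>

definition reduce :: "int poly \<Rightarrow> int poly \<Rightarrow> int poly" where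
  "reduce f q = (\<Sum>n\<le>degree q. smult (coeff q n) (xrem f n))"

text \<open>Multiplication by \<open>h\<close> on Z[X]/(f) in the basis 1, X, ..., X^(d-1); column
  \<open>j\<close> is the image of X^j. For monic \<open>f\<close> of positive degree its
  determinant is the norm of \<open>h\<close>, that is, the resultant of \<open>f\<close> and
  \<open>h\<close>.\<close>

definition mult_mat :: "int poly \<Rightarrow> int poly \<Rightarrow> int mat" where
  "mult_mat f h = mat (degree f) (degree f) (\<lambda>(i, j). coeff (reduce f (h * monom 1 j)) i)"

definition norm_mod :: "int poly \<Rightarrow> int poly \<Rightarrow> int" where
  "norm_mod f h = det (mult_mat f h)"

lemma coeff_xrem_eq_0:
  assumes "lead_coeff f = 1" "degree f \<ge> 1" "i \<ge> degree f"
  shows "coeff (xrem f n) i = 0"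
  using assms(3)
proof (induction n arbitrary: i)
  case 0
  then show ?case using assms(2) by (simp add: coeff_eq_0)
next
  case (Suc n)
  show ?case
  proof (cases "i = degree f")
    case True
    then show ?thesis using assms(1) by simp
  next
    case False
    then have "i > degree f" using Suc.prems by simp
    then have "coeff f i = 0" by (rule coeff_eq_0)
    moreover have "coeff (pCons 0 (xrem f n)) i = 0"
      using \<open>i > degree f\<close> Suc.IH[of "i - 1"] by (cases i) auto
    ultimately show ?thesis by simp
  qed
qed

lemma dvd_xrem: "f dvd monom 1 n - xrem f n"
proof (induction n)
  case (Suc n)
  then obtain w where "monom 1 n - xrem f n = f * w" by (auto elim: dvdE)
  then have w: "pCons 0 (monom 1 n - xrem f n) = f * pCons 0 w" by simp
  have eq: "monom 1 (Suc n) - xrem f (Suc n)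
      = pCons 0 (monom 1 n - xrem f n) + smult (coeff (pCons 0 (xrem f n)) (degree f)) f"
    by (simp add: monom_Suc)
  have "f dvd f * pCons 0 w + smult (coeff (pCons 0 (xrem f n)) (degree f)) f"
    by (intro dvd_add dvd_smult dvd_triv_left dvd_refl)
  then show ?case by (simp only: eq w)
qed simp

lemma reduce_eq:
  assumes "degree q \<le> K"
  shows "reduce f q = (\<Sum>n\<le>K. smult (coeff q n) (xrem f n))"
  unfolding reduce_def using assms by (intro sum.mono_neutral_left) (auto simp: coeff_eq_0)

lemma reduce_add: "reduce f (p + q) = reduce f p + reduce f q"
proof -
  define K where "K = max (degree p) (degree q)"
  have "degree (p + q) \<le> K" "degree p \<le> K" "degree q \<le> K"
    unfolding K_def by (auto intro: degree_add_le)
  then show ?thesis by (simp add: reduce_eq smult_add_left sum.distrib)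
qed

lemma reduce_smult: "reduce f (smult c q) = smult c (reduce f q)"
proof -
  have "degree (smult c q) \<le> degree q" by simp
  then show ?thesis 
    by (intro poly_eqI) (simp add: reduce_eq[of _ "degree q"] coeff_sum sum_distrib_left mult.assoc)
qed

lemma reduce_0 [simp]: "reduce f 0 = 0"
  by (simp add: reduce_def)

lemma reduce_sum: "finite I \<Longrightarrow> reduce f (\<Sum>i\<in>I. q i) = (\<Sum>i\<in>I. reduce f (q i))"
  by (induction I rule: finite_induct) (auto simp: reduce_add)

lemma dvd_reduce: "f dvd q - reduce f q"
proof -
  have "q - reduce f q = (\<Sum>n\<le>degree q. smult (coeff q n) (monom 1 n - xrem f n))"
    unfolding reduce_def
    by (simp add: smult_diff_right sum_subtractf smult_monom poly_as_sum_of_monoms)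
  then show ?thesis using dvd_xrem by (auto intro!: dvd_sum dvd_smult)
qed

lemma coeff_reduce_eq_0:
  assumes "lead_coeff f = 1" "degree f \<ge> 1" "i \<ge> degree f"
  shows "coeff (reduce f q) i = 0"
  using coeff_xrem_eq_0[OF assms] by (simp add: reduce_def coeff_sum)

section \<open>The multiplication matrix and its determinant\<close>

lemma mult_mat_carrier [simp]: "mult_mat f h \<in> carrier_mat (degree f) (degree f)"
  by (simp add: mult_mat_def)

lemma dim_mult_mat [simp]:
  "dim_row (mult_mat f h) = degree f" "dim_col (mult_mat f h) = degree f"
  by (simp_all add: mult_mat_def)

definition vec_poly :: "int Matrix.vec \<Rightarrow> int poly" where
  "vec_poly v = (\<Sum>j<dim_vec v. monom (v $ j) j)"

lemma coeff_vec_poly: "coeff (vec_poly v) i = (if i < dim_vec v then v $ i else 0)"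
  by (simp add: vec_poly_def coeff_sum coeff_monom)

lemma mult_mat_vec:
  assumes "v \<in> carrier_vec (degree f)" "i < degree f"
  shows "(mult_mat f h *\<^sub>v v) $ i = coeff (reduce f (h * vec_poly v)) i"
proof -
  have "h * vec_poly v = (\<Sum>j<degree f. smult (v $ j) (h * monom 1 j))"
    using assms by (simp add: vec_poly_def sum_distrib_left smult_monom flip: mult_smult_right)
  then have "coeff (reduce f (h * vec_poly v)) i = (\<Sum>j<degree f. v $ j * coeff (reduce f (h * monom 1 j)) i)"
    by (simp add: reduce_sum reduce_smult coeff_sum)
  also have "\<dots> = (mult_mat f h *\<^sub>v v) $ i"
    using assms by (auto simp: mult_mat_def scalar_prod_def lessThan_atLeast0 intro!: sum.cong)
  finally show ?thesis by simp
qed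

text \<open>A kernel vector, read as a polynomial v, satisfies f | h v. Irreducible elements of Z[X]
  are prime, so \<open>f\<close> would divide h or v, both nonzero of smaller degree.\<close>

lemma norm_mod_nonzero:
  assumes "lead_coeff f = 1" "irreducible f" "degree f \<ge> 1" "h \<noteq> 0" "degree h < degree f"
  shows "norm_mod f h \<noteq> 0"
proof
  assume "norm_mod f h = 0"
  then obtain v where v: "v \<in> carrier_vec (degree f)" "v \<noteq> 0\<^sub>v (degree f)"
      "mult_mat f h *\<^sub>v v = 0\<^sub>v (degree f)"
    unfolding norm_mod_def by (auto simp: det_0_iff_vec_prod_zero[OF mult_mat_carrier])
  have "coeff (reduce f (h * vec_poly v)) i = 0" for i
  proof (cases "i < degree f")
    case True
    then show ?thesis using mult_mat_vec[OF v(1), of i h] v(3) by simp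
  next
    case False
    then show ?thesis using coeff_reduce_eq_0 assms(1,3) by simp
  qed
  then have "reduce f (h * vec_poly v) = 0" by (simp add: poly_eq_iff)
  then have "f dvd h * vec_poly v" using dvd_reduce[of f "h * vec_poly v"] by simp
  moreover have "prime_elem f" using assms(2) by (rule irreducible_imp_prime_elem)
  ultimately have "f dvd h \<or> f dvd vec_poly v" by (simp add: prime_elem_dvd_mult_iff)
  moreover have "vec_poly v \<noteq> 0"
  proof
    assume "vec_poly v = 0"
    then have "v $ i = 0" if "i < degree f" for i using coeff_vec_poly[of v i] v(1) that by simp
    then have "v = 0\<^sub>v (degree f)" using v(1) by (intro eq_vecI) auto
    then show False using v(2) by contradiction
  qed
  moreover have "degree (vec_poly v) < degree f"
    using v(1) coeff_vec_poly[of v] \<open>vec_poly v \<noteq> 0\<close>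
    by (metis carrier_vecD leading_coeff_0_iff)
  ultimately show False using assms(4,5) dvd_imp_degree_le[of f h] dvd_imp_degree_le[of f "vec_poly v"]
    by (meson not_le)
qed

text \<open>Cramer's rule: the first column of the adjugate, read as a polynomial, multiplies
  \<open>h\<close> to the constant \<open>norm_mod f h\<close> modulo \<open>f\<close>.\<close>

lemma norm_mod_combination:
  assumes "lead_coeff f = 1" "degree f \<ge> 1"
  shows "\<exists>u. f dvd h * u - [:norm_mod f h:]"
proof -
  let ?d = "degree f"
  let ?A = "mult_mat f h"
  define v where "v = adj_mat ?A *\<^sub>v unit_vec ?d 0"
  have A: "?A \<in> carrier_mat ?d ?d" by simp
  have adj: "adj_mat ?A \<in> carrier_mat ?d ?d" using adj_mat(1)[OF A] .
  have v: "v \<in> carrier_vec ?d" unfolding v_def using adj by simp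
  have "?A *\<^sub>v v = (?A * adj_mat ?A) *\<^sub>v unit_vec ?d 0"
    unfolding v_def using A adj by (intro assoc_mult_mat_vec[OF A adj, symmetric]) auto
  also have "\<dots> = norm_mod f h \<cdot>\<^sub>v unit_vec ?d 0"
    unfolding norm_mod_def adj_mat(2)[OF A] by auto
  finally have eq: "?A *\<^sub>v v = norm_mod f h \<cdot>\<^sub>v unit_vec ?d 0" .
  have "reduce f (h * vec_poly v) = [:norm_mod f h:]"
  proof (rule poly_eqI)
    fix i
    show "coeff (reduce f (h * vec_poly v)) i = coeff [:norm_mod f h:] i"
    proof (cases "i < ?d")
      case True
      then show ?thesis using mult_mat_vec[OF v True, of h] eq assms(2)
        by (auto simp: coeff_pCons split: nat.split)
    next
      case False
      then show ?thesis using coeff_reduce_eq_0[OF assms, of i] assms(2)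
        by (auto simp: coeff_pCons split: nat.split)
    qed
  qed
  then show ?thesis using dvd_reduce[of f "h * vec_poly v"] by auto
qed

lemma abs_det_le:
  fixes M :: "int mat"
  assumes "M \<in> carrier_mat n n" "\<And>i j. i < n \<Longrightarrow> j < n \<Longrightarrow> \<bar>M $$ (i, j)\<bar> \<le> K"
  shows "\<bar>det M\<bar> \<le> fact n * K ^ n"
proof -
  have "\<bar>det M\<bar> \<le> (\<Sum>\<pi> | \<pi> permutes {0..<n}. \<bar>signof \<pi> * (\<Prod>i=0..<n. M $$ (i, \<pi> i))\<bar>)"
    unfolding det_def'[OF assms(1)] by (rule sum_abs)
  also have "\<dots> \<le> (\<Sum>\<pi> | \<pi> permutes {0..<n}. K ^ n)"
  proof (rule sum_mono)
    fix \<pi> assume "\<pi> \<in> {\<pi>. \<pi> permutes {0..<n}}"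
    then have \<pi>: "\<pi> permutes {0..<n}" by simp
    have "\<pi> i < n" if "i < n" for i using permutes_in_image[OF \<pi>, of i] that by simp
    then have "(\<Prod>i=0..<n. \<bar>M $$ (i, \<pi> i)\<bar>) \<le> (\<Prod>i=0..<n. K)"
      using assms(2) by (intro prod_mono) auto
    then show "\<bar>signof \<pi> * (\<Prod>i=0..<n. M $$ (i, \<pi> i))\<bar> \<le> K ^ n"
      by (simp add: abs_mult abs_prod sign_def)
  qed
  also have "\<dots> = fact n * K ^ n" using card_permutations[of "{0..<n}" n] by simp
  finally show ?thesis .
qed

lemma abs_norm_mod_le:
  assumes "degree f \<ge> 1"
  shows "\<exists>H\<ge>0. \<forall>h A. degree h < degree f \<longrightarrow> A \<ge> 0 \<longrightarrow> (\<forall>i. \<bar>coeff h i\<bar> \<le> A) \<longrightarrow>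
    \<bar>norm_mod f h\<bar> \<le> H * A ^ degree f"
proof -
  let ?d = "degree f"
  \<comment> \<open>Each product of \<open>h\<close> with X^j, j < d, has degree below 2d, so
    finitely many remainders of powers of X bound all matrix entries linearly in the coefficients of
    \<open>h\<close>.\<close>
  define K where "K = (\<Sum>n\<le>2 * ?d. \<Sum>i<?d. \<bar>coeff (xrem f n) i\<bar>)"
  have "\<bar>norm_mod f h\<bar> \<le> (fact ?d * K ^ ?d) * A ^ ?d"
    if h: "degree h < ?d" "A \<ge> 0" "\<And>i. \<bar>coeff h i\<bar> \<le> A" for h A
  proof -
    have "\<bar>mult_mat f h $$ (i, j)\<bar> \<le> A * K" if ij: "i < ?d" "j < ?d" for i j
    proof -
      let ?g = "h * monom 1 j"
      have "degree ?g \<le> degree h + degree (monom (1::int) j)" by (rule degree_mult_le)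
      also have "\<dots> \<le> 2 * ?d" using h(1) ij by (simp add: degree_monom_eq)
      finally have dg: "degree ?g \<le> 2 * ?d" .
      have cg: "\<bar>coeff ?g n\<bar> \<le> A" for n
        using h(2,3) by (simp add: mult.commute[of h] coeff_monom_mult)
      have "\<bar>mult_mat f h $$ (i, j)\<bar> = \<bar>\<Sum>n\<le>2 * ?d. coeff ?g n * coeff (xrem f n) i\<bar>"
        using ij by (simp add: mult_mat_def reduce_eq[OF dg] coeff_sum)
      also have "\<dots> \<le> (\<Sum>n\<le>2 * ?d. \<bar>coeff ?g n\<bar> * \<bar>coeff (xrem f n) i\<bar>)"
        by (rule order_trans[OF sum_abs]) (simp add: abs_mult)
      also have "\<dots> \<le> (\<Sum>n\<le>2 * ?d. A * (\<Sum>i<?d. \<bar>coeff (xrem f n) i\<bar>))"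
        using cg ij h(2) by (intro sum_mono mult_mono member_le_sum) (auto intro: sum_nonneg)
      also have "\<dots> = A * K" by (simp add: K_def sum_distrib_left)
      finally show ?thesis .
    qed
    then have "\<bar>norm_mod f h\<bar> \<le> fact ?d * (A * K) ^ ?d"
      unfolding norm_mod_def by (intro abs_det_le) auto
    then show ?thesis by (simp add: power_mult_distrib mult_ac)
  qed
  moreover have "fact ?d * K ^ ?d \<ge> 0" unfolding K_def by (intro mult_nonneg_nonneg zero_le_power sum_nonneg) auto
  ultimately show ?thesis by blast
qed

text \<open>Every term of the Leibniz expansion takes one factor from each of the first
  \<open>m\<close> rows.\<close>

lemma power_dvd_det:
  fixes M :: "int mat"
  assumes "M \<in> carrier_mat n n" "m \<le> n" "\<And>i j. i < m \<Longrightarrow> j < n \<Longrightarrow> p dvd M $$ (i, j)"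
  shows "p ^ m dvd det M"
  unfolding det_def'[OF assms(1)]
proof (intro dvd_sum dvd_mult)
  fix \<pi> assume "\<pi> \<in> {\<pi>. \<pi> permutes {0..<n}}"
  then have \<pi>: "\<pi> permutes {0..<n}" by simp
  have "\<pi> i < n" if "i < n" for i using permutes_in_image[OF \<pi>, of i] that by simp
  then have "(\<Prod>i=0..<m. p) dvd (\<Prod>i=0..<m. M $$ (i, \<pi> i))"
    using assms(2,3) by (intro prod_dvd_prod) auto
  also have "\<dots> dvd (\<Prod>i=0..<n. M $$ (i, \<pi> i))"
    using assms(2) by (intro prod_dvd_prod_subset) auto
  finally show "p ^ m dvd (\<Prod>i=0..<n. M $$ (i, \<pi> i))" by simp
qed

text \<open>The Newton interpolation polynomials at the nodes r 0, r 1, ...; the one of index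
  \<open>j\<close> vanishes at the first \<open>j\<close> nodes.\<close>

definition newton_basis :: "(nat \<Rightarrow> int) \<Rightarrow> nat \<Rightarrow> int poly" where
  "newton_basis r j = (\<Prod>i<j. [:- r i, 1:])"

lemma degree_newton_basis: "degree (newton_basis r j) = j"
  by (simp add: newton_basis_def degree_prod_eq_sum_degree)

lemma lead_coeff_newton_basis: "coeff (newton_basis r j) j = 1"
proof -
  have "lead_coeff (newton_basis r j) = 1" by (simp add: newton_basis_def lead_coeff_prod)
  then show ?thesis by (simp add: degree_newton_basis)
qed

lemma poly_newton_basis: "poly (newton_basis r j) x = (\<Prod>i<j. x - r i)"
  by (simp add: newton_basis_def poly_prod)

text \<open>In the Newton basis at the points of \<open>R\<close>, the first \<open>card R\<close> rows of the matrix of multiplication by \<open>h\<close> are divisible by \<open>p\<close>.\<close>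

lemma prime_power_dvd_norm_mod:
  assumes "lead_coeff f = 1" "degree f \<ge> 1" "prime p" "R \<subseteq> {0..<p}"
    and "\<And>x. x \<in> R \<Longrightarrow> p dvd poly f x" "\<And>x. x \<in> R \<Longrightarrow> p dvd poly h x"
  shows "p ^ card R dvd norm_mod f h"
proof -
  let ?d = "degree f" and ?M = "mult_mat f h"
  define m where "m = card R"
  have finR: "finite R" using assms(4) finite_subset by blast
  have ndvd: "\<not> p dvd x - y" if "x \<in> R" "y \<in> R" "x \<noteq> y" for x y
  proof
    assume "p dvd x - y"
    then have "\<bar>p\<bar> \<le> \<bar>x - y\<bar>" using that(3) by (intro dvd_imp_le_int) auto
    moreover have "x \<in> {0..<p}" "y \<in> {0..<p}" using that assms(4) by blast+
    ultimately show False by auto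
  qed
  have m: "m \<le> ?d" unfolding m_def
    using ndvd by (intro card_roots_mod_prime_le[OF assms(3,1) finR assms(5)]) auto
  obtain rs where rs: "set rs = R" "distinct rs" using finite_distinct_list[OF finR] by blast
  have len: "length rs = m" using rs distinct_card[of rs] by (simp add: m_def)
  \<comment> \<open>The value 0 beyond the \<open>m\<close> roots only fills up the nodes to obtain
    \<open>d\<close> basis polynomials; the divisibility concerns rows below
    \<open>m\<close>.\<close>
  define r where "r i = (if i < m then rs ! i else 0)" for i
  have rR: "r i \<in> R" if "i < m" for i using that len rs by (auto simp: r_def)
  have r_neq: "r i \<noteq> r l" if "i < m" "l < i" for i l
    using that len rs by (auto simp: r_def nth_eq_iff_index_eq)
  \<comment> \<open>The change of basis is unipotent, so its inverse is integral and conjugation by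
    it preserves the determinant.\<close>
  define T where "T = mat ?d ?d (\<lambda>(i, j). coeff (newton_basis r j) i)"
  have T: "T \<in> carrier_mat ?d ?d" by (simp add: T_def)
  have ones: "prod_list (map (\<lambda>_. 1::int) xs) = 1" for xs :: "nat list" by (induction xs) auto
  have "upper_triangular T" by (auto simp: T_def coeff_eq_0 degree_newton_basis)
  then have "det T = prod_list (diag_mat T)" using T by (rule det_upper_triangular)
  also have "diag_mat T = map (\<lambda>_. 1) [0..<?d]"
    by (auto simp: diag_mat_def T_def lead_coeff_newton_basis intro!: map_cong)
  also have "prod_list \<dots> = (1::int)" by (rule ones)
  finally have dT: "det T = 1" .
  define T' where "T' = adj_mat T"
  have T': "T' \<in> carrier_mat ?d ?d" "T * T' = 1\<^sub>m ?d" "T' * T = 1\<^sub>m ?d"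
    using adj_mat[OF T] dT by (auto simp: T'_def)
  define N where "N = T' * (?M * T)"
  have M: "?M \<in> carrier_mat ?d ?d" by simp
  have MT: "?M * T \<in> carrier_mat ?d ?d" using M T by (rule mult_carrier_mat)
  have N: "N \<in> carrier_mat ?d ?d" unfolding N_def using T'(1) MT by (rule mult_carrier_mat)
  have "det T' * det T = det (T' * T)" using det_mult[OF T'(1) T] by simp
  then have "det T' = 1" using dT T'(3) by simp
  then have detN: "det N = det ?M"
    unfolding N_def using det_mult[OF T'(1) MT] det_mult[OF M T] dT by simp
  have "T * N = (T * T') * (?M * T)" unfolding N_def using T T'(1) MT by (intro assoc_mult_mat[symmetric])
  then have TN: "T * N = ?M * T" by (simp only: T'(2) left_mult_one_mat[OF MT])
  \<comment> \<open>Column \<open>j\<close> of \<open>N\<close> holds the Newton coordinates of the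
    reduced product \<open>q\<close>, and \<open>p\<close> divides q(r i). At \<open>r i\<close> the
    later basis polynomials vanish and the earlier coordinates are divisible by induction, which
    isolates coordinate \<open>i\<close> times a product of node differences prime to
    \<open>p\<close>.\<close>
  have "p dvd N $$ (i, j)" if "i < m" "j < ?d" for i j
    using that(1)
  proof (induction i rule: less_induct)
    case (less i)
    define q where "q = reduce f (h * newton_basis r j)"
    have id: "i < ?d" using less.prems m by simp
    have col: "vec_poly (col T j) = newton_basis r j"
      using that(2) by (intro poly_eqI) (auto simp: coeff_vec_poly T_def coeff_eq_0 degree_newton_basis)
    have q: "q = (\<Sum>l<?d. smult (N $$ (l, j)) (newton_basis r l))"
    proof (rule poly_eqI)
      fix k
      show "coeff q k = coeff (\<Sum>l<?d. smult (N $$ (l, j)) (newton_basis r l)) k"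
      proof (cases "k < ?d")
        case True
        have "coeff q k = (?M *\<^sub>v col T j) $ k"
          unfolding q_def using mult_mat_vec[of "col T j" f k h] T that(2) True col by simp
        also have "\<dots> = (?M * T) $$ (k, j)" using M T True that(2) by simp
        also have "\<dots> = (T * N) $$ (k, j)" by (simp only: TN)
        also have "\<dots> = (\<Sum>l<?d. coeff (newton_basis r l) k * N $$ (l, j))"
          using T N True that(2)
          by (auto simp: scalar_prod_def T_def lessThan_atLeast0 intro!: sum.cong)
        finally show ?thesis by (simp add: coeff_sum mult.commute)
      next
        case False
        then show ?thesis using coeff_reduce_eq_0[OF assms(1,2), of k]
          by (simp add: q_def coeff_sum coeff_eq_0 degree_newton_basis)
      qed
    qed
    have "poly q (r i) = (\<Sum>l<?d. N $$ (l, j) * poly (newton_basis r l) (r i))"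
      by (simp add: q poly_sum)
    also have "\<dots> = (\<Sum>l<Suc i. N $$ (l, j) * poly (newton_basis r l) (r i))"
      using id by (intro sum.mono_neutral_right) (auto simp: poly_newton_basis)
    finally have pq: "poly q (r i) = (\<Sum>l<i. N $$ (l, j) * poly (newton_basis r l) (r i))
        + N $$ (i, j) * poly (newton_basis r i) (r i)" by simp
    have "f dvd h * newton_basis r j - q" unfolding q_def by (rule dvd_reduce)
    then obtain w where "h * newton_basis r j - q = f * w" by (elim dvdE)
    then have "poly (h * newton_basis r j - q) (r i) = poly (f * w) (r i)" by simp
    then have "poly q (r i) = poly h (r i) * poly (newton_basis r j) (r i) - poly f (r i) * poly w (r i)"
      by (simp add: algebra_simps)
    moreover have "p dvd \<dots>" using rR[OF less.prems] assms(5,6) by (intro dvd_diff dvd_mult2) auto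
    ultimately have "p dvd poly q (r i)" by simp
    moreover have "p dvd (\<Sum>l<i. N $$ (l, j) * poly (newton_basis r l) (r i))"
      using less by (intro dvd_sum dvd_mult2) auto
    ultimately have "p dvd N $$ (i, j) * poly (newton_basis r i) (r i)"
      unfolding pq by (simp add: dvd_add_right_iff)
    moreover have "\<not> p dvd poly (newton_basis r i) (r i)"
      unfolding poly_newton_basis using less.prems ndvd rR r_neq assms(3)
      by (auto simp: prime_dvd_prod_iff)
    ultimately show ?case using assms(3) by (simp add: prime_dvd_mult_iff)
  qed
  then have "p ^ m dvd det N" using N m by (intro power_dvd_det) auto
  then show ?thesis by (simp add: detN norm_mod_def m_def)
qed

section \<open>A Mertens-type upper bound\<close>

definition num_roots_mod :: "int poly \<Rightarrow> int \<Rightarrow> nat" where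
  "num_roots_mod f p = card {r\<in>{0..<p}. p dvd poly f r}"

lemma num_roots_mod_le_degree:
  assumes "lead_coeff f = 1" "prime p"
  shows "num_roots_mod f p \<le> degree f"
  unfolding num_roots_mod_def
proof (rule card_roots_mod_prime_le[OF assms(2,1)])
  fix y z assume "y \<in> {r\<in>{0..<p}. p dvd poly f r}" "z \<in> {r\<in>{0..<p}. p dvd poly f r}" "y \<noteq> z"
  then have "\<bar>z - y\<bar> < \<bar>p\<bar>" "z - y \<noteq> 0" by auto
  then show "\<not> p dvd z - y" using dvd_imp_le_int[of "z - y" p] by auto
qed (auto intro: finite_subset[of _ "{0..<p}"])

section \<open>Boxes of polynomials and collisions modulo primes\<close>

definition poly_box :: "nat \<Rightarrow> nat \<Rightarrow> int poly set" where
  "poly_box d A = Poly ` {xs. set xs \<subseteq> {0..<int A} \<and> length xs = d}"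

lemma finite_poly_box: "finite (poly_box d A)"
  unfolding poly_box_def by (intro finite_imageI finite_lists_length_eq) simp

lemma card_poly_box: "card (poly_box d A) = A ^ d"
proof -
  have "inj_on Poly {xs. set xs \<subseteq> {0..<int A} \<and> length xs = d}"
  proof (rule inj_onI)
    fix xs ys assume xs: "xs \<in> {xs. set xs \<subseteq> {0..<int A} \<and> length xs = d}"
      and ys: "ys \<in> {xs. set xs \<subseteq> {0..<int A} \<and> length xs = d}" and eq: "Poly xs = Poly ys"
    have "nth_default 0 xs i = nth_default 0 ys i" for i
      using arg_cong[OF eq, of "\<lambda>q. coeff q i"] by (simp add: coeff_Poly_eq)
    then show "xs = ys" using xs ys by (intro nth_equalityI) (auto, metis nth_default_nth)
  qed
  then show ?thesis unfolding poly_box_def by (subst card_image) (simp_all add: card_lists_length_eq)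
qed

lemma coeff_poly_box: "h \<in> poly_box d A \<Longrightarrow> coeff h i = 0 \<or> (0 \<le> coeff h i \<and> coeff h i < int A)"
  unfolding poly_box_def using nth_mem by (fastforce simp: coeff_Poly_eq nth_default_def subset_iff)

lemma coeff_poly_box_eq_0: "h \<in> poly_box d A \<Longrightarrow> i \<ge> d \<Longrightarrow> coeff h i = 0"
  unfolding poly_box_def by (auto simp: coeff_Poly_eq nth_default_def)

text \<open>Cauchy-Schwarz applied to the fibre sizes. The pairs are ordered and include the
  diagonal.\<close>

lemma card_collisions_ge:
  assumes "finite B" "finite C" "\<phi> ` B \<subseteq> C"
  shows "(real (card B))\<^sup>2 \<le> real (card C) * real (card {(a, b) \<in> B \<times> B. \<phi> a = \<phi> b})"
proof -
  define n where "n c = card {a\<in>B. \<phi> a = c}" for c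
  have 1: "card B = (\<Sum>c\<in>C. n c)"
    unfolding n_def using assms by (subst card_UN_disjoint[symmetric]) (auto intro!: arg_cong[of _ _ card])
  have "{(a, b) \<in> B \<times> B. \<phi> a = \<phi> b} = (\<Union>c\<in>C. {a\<in>B. \<phi> a = c} \<times> {a\<in>B. \<phi> a = c})"
    using assms(3) by auto
  then have 2: "card {(a, b) \<in> B \<times> B. \<phi> a = \<phi> b} = (\<Sum>c\<in>C. n c * n c)"
    unfolding n_def using assms
    by (simp only:) (subst card_UN_disjoint, auto simp: card_cartesian_product)
  have "(\<Sum>c\<in>C. real (n c))\<^sup>2 \<le> (\<Sum>c\<in>C. (real (n c))\<^sup>2) * real (card C)"
    by (rule sum_squared_le_sum_of_squares)
  then show ?thesis unfolding 1 2 by (simp add: power2_eq_square mult.commute)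
qed

text \<open>For each prime, the power given by the number of common roots divides the norm. Powers
  of distinct primes are coprime, so their product divides the nonzero norm and is bounded by
  it.\<close>

lemma sum_common_roots_le:
  assumes "lead_coeff f = 1" "irreducible f" "degree f \<ge> 1"
    and "g \<noteq> 0" "degree g < degree f" "finite P" "\<And>p. p \<in> P \<Longrightarrow> prime p"
  shows "(\<Sum>p\<in>P. real (card {r\<in>{0..<p}. p dvd poly f r \<and> p dvd poly g r}) * ln (real_of_int p))
    \<le> ln (real_of_int \<bar>norm_mod f g\<bar>)"
proof -
  define e where "e p = card {r\<in>{0..<p}. p dvd poly f r \<and> p dvd poly g r}" for p
  have pos: "p > 0" if "p \<in> P" for p using assms(7)[OF that] prime_gt_0_int by blast
  have nz: "norm_mod f g \<noteq> 0" using norm_mod_nonzero assms by blast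
  have "(\<Prod>p\<in>P. p ^ e p) dvd norm_mod f g"
    unfolding e_def using assms
    by (intro prod_primes_dvd prime_power_dvd_norm_mod[OF assms(1,3)]) auto
  then have "\<bar>\<Prod>p\<in>P. p ^ e p\<bar> \<le> \<bar>norm_mod f g\<bar>" using nz by (intro dvd_imp_le_int)
  moreover have pp: "(\<Prod>p\<in>P. p ^ e p) > 0" using pos by (intro prod_pos) auto
  ultimately have le: "real_of_int (\<Prod>p\<in>P. p ^ e p) \<le> real_of_int \<bar>norm_mod f g\<bar>" by linarith
  have "(\<Sum>p\<in>P. real (e p) * ln (real_of_int p)) = ln (\<Prod>p\<in>P. real_of_int p ^ e p)"
    using pos assms(6) by (subst ln_prod) (auto simp: ln_realpow)
  also have "\<dots> \<le> ln (real_of_int \<bar>norm_mod f g\<bar>)"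
    using le pp nz by (subst ln_le_cancel_iff) (auto simp flip: of_int_power of_int_prod)
  finally show ?thesis by (simp add: e_def)
qed

lemma mertens_poly_box:
  assumes "lead_coeff f = 1" "irreducible f" "degree f = d" "d \<ge> 1"
  shows "\<exists>C. \<forall>A\<ge>1. (\<Sum>p | prime p \<and> p \<le> int (A ^ d). real (num_roots_mod f p) * ln (real_of_int p) / real_of_int p)
    \<le> real d * ln (real A) + C"
proof -
  obtain H where H: "H \<ge> 0" "\<And>h A. degree h < d \<Longrightarrow> A \<ge> 0 \<Longrightarrow> (\<And>i. \<bar>coeff h i\<bar> \<le> A) \<Longrightarrow>
      \<bar>norm_mod f h\<bar> \<le> H * A ^ d"
    using abs_norm_mod_le[of f] assms(3,4) by blast
  \<comment> \<open>Using H + 1 instead of \<open>H\<close> makes the logarithm nonnegative even if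
    \<open>H\<close> is 0.\<close>
  define L where "L = ln (real_of_int (H + 1))"
  have L0: "L \<ge> 0" unfolding L_def using H(1) by simp
  show ?thesis
  proof (intro exI[of _ "L + real d * ln 4"] allI impI)
    fix A :: nat assume A: "A \<ge> 1"
    define B where "B = poly_box d A"
    define P where "P = {p. prime p \<and> p \<le> int (A ^ d)}"
    define n where "n = real (card B)"
    have n: "n = real (A ^ d)" "n \<ge> 1" unfolding n_def B_def card_poly_box using A by simp_all
    have finB: "finite B" unfolding B_def by (rule finite_poly_box)
    have finP: "finite P" unfolding P_def by simp
    have P: "prime p" "p > 1" if "p \<in> P" for p using that prime_gt_1_int unfolding P_def by auto
    define W where "W = {(a, b) \<in> B \<times> B. a \<noteq> b}"
    define Rt where "Rt p = {r\<in>{0..<p}. p dvd poly f r}" for p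
    define D where "D p r = {(a, b) \<in> W. p dvd poly (a - b) r}" for p r
    have finW: "finite W" 
      by (rule finite_subset[of _ "B \<times> B"]) (use finB in \<open>auto simp: W_def\<close>)
    have finRt: "finite (Rt p)" for p unfolding Rt_def by (rule finite_subset[of _ "{0..<p}"]) auto
    have cW: "real (card W) \<le> n\<^sup>2"
    proof -
      have "card W \<le> card (B \<times> B)" unfolding W_def using finB by (intro card_mono) auto
      then have "real (card W) \<le> real (card B * card B)" unfolding card_cartesian_product by (rule of_nat_mono)
      then show ?thesis by (simp add: n_def power2_eq_square)
    qed
    have upper: "(\<Sum>p\<in>P. real (card {r\<in>Rt p. p dvd poly (a - b) r}) * ln (real_of_int p)) \<le> real d * ln (real A) + L"
      if ab: "(a, b) \<in> W" for a b
    proof -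
      have "a \<in> B" "b \<in> B" "a \<noteq> b" using ab unfolding W_def by auto
      then have c0: "coeff (a - b) i = 0" if "i \<ge> d" for i
        using that coeff_poly_box_eq_0 unfolding B_def by simp
      have dg: "degree (a - b) < d" using c0[of "degree (a - b)"] \<open>a \<noteq> b\<close>
        by (meson leading_coeff_0_iff not_le right_minus_eq)
      have cb: "\<bar>coeff (a - b) i\<bar> \<le> int A" for i
        using coeff_poly_box[of a d A i] coeff_poly_box[of b d A i] \<open>a \<in> B\<close> \<open>b \<in> B\<close> unfolding B_def by auto
      have nz: "norm_mod f (a - b) \<noteq> 0"
        using norm_mod_nonzero[OF assms(1,2), of "a - b"] dg assms(3,4) \<open>a \<noteq> b\<close> by simp
      have "\<bar>norm_mod f (a - b)\<bar> \<le> H * int A ^ d" using dg cb by (intro H(2)) auto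
      also have "\<dots> \<le> (H + 1) * int A ^ d" by (intro mult_right_mono) auto
      finally have "real_of_int \<bar>norm_mod f (a - b)\<bar> \<le> real_of_int ((H + 1) * int A ^ d)" by linarith
      then have "ln (real_of_int \<bar>norm_mod f (a - b)\<bar>) \<le> ln (real_of_int (H + 1) * real A ^ d)"
        using nz A H(1) by (subst ln_le_cancel_iff) auto
      also have "\<dots> = real d * ln (real A) + L"
        unfolding L_def using A H(1) by (subst ln_mult) (auto simp: ln_realpow)
      finally have "ln (real_of_int \<bar>norm_mod f (a - b)\<bar>) \<le> real d * ln (real A) + L" .
      moreover have "(\<Sum>p\<in>P. real (card {r\<in>{0..<p}. p dvd poly f r \<and> p dvd poly (a - b) r}) * ln (real_of_int p))
          \<le> ln (real_of_int \<bar>norm_mod f (a - b)\<bar>)"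
        using assms dg \<open>a \<noteq> b\<close> P finP by (intro sum_common_roots_le) auto
      ultimately show ?thesis unfolding Rt_def by (simp add: conj_assoc)
    qed
    \<comment> \<open>Double counting of triples: a pair of distinct polynomials, a prime, and a
      root of \<open>f\<close> modulo it at which the pair agrees.\<close>
    have swap: "(\<Sum>(a, b)\<in>W. \<Sum>p\<in>P. real (card {r\<in>Rt p. p dvd poly (a - b) r}) * ln (real_of_int p))
        = (\<Sum>p\<in>P. ln (real_of_int p) * (\<Sum>r\<in>Rt p. real (card (D p r))))"
    proof -
      have "(\<Sum>w\<in>W. real (card {r\<in>Rt p. p dvd poly (fst w - snd w) r})) = (\<Sum>r\<in>Rt p. real (card (D p r)))" for p
      proof -
        have "(\<Sum>w\<in>W. real (card {r\<in>Rt p. p dvd poly (fst w - snd w) r}))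
            = (\<Sum>w\<in>W. \<Sum>r\<in>Rt p. of_bool (p dvd poly (fst w - snd w) r))"
          using finRt by (simp add: of_bool_def sum.If_cases Int_def)
        also have "\<dots> = (\<Sum>r\<in>Rt p. \<Sum>w\<in>W. of_bool (p dvd poly (fst w - snd w) r))" by (rule sum.swap)
        also have "\<dots> = (\<Sum>r\<in>Rt p. real (card (D p r)))"
          using finW by (simp add: of_bool_def sum.If_cases Int_def D_def case_prod_unfold)
        finally show ?thesis .
      qed
      then show ?thesis
        by (simp add: case_prod_unfold sum.swap[of _ P W] mult.commute flip: sum_distrib_left)
    qed
    \<comment> \<open>The values at \<open>r\<close> fall into \<open>p\<close> classes, giving at
      least n^2/p agreeing pairs, of which at most \<open>n\<close> are diagonal.\<close>
    have lower: "real (card (D p r)) \<ge> n\<^sup>2 / real_of_int p - n" if p: "p \<in> P" for p r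
    proof -
      let ?E = "{(a, b) \<in> B \<times> B. poly a r mod p = poly b r mod p}"
      have "n\<^sup>2 \<le> real (card {0..<p}) * real (card ?E)"
        unfolding n_def using finB P[OF p] by (intro card_collisions_ge) auto
      then have "n\<^sup>2 / real_of_int p \<le> real (card ?E)" using P[OF p] by (simp add: divide_le_eq mult.commute)
      also have "?E \<subseteq> D p r \<union> (\<lambda>a. (a, a)) ` B"
        unfolding D_def W_def by (auto simp: mod_eq_dvd_iff)
      then have "card ?E \<le> card (D p r \<union> (\<lambda>a. (a, a)) ` B)"
        using finB finW by (intro card_mono) (auto simp: D_def case_prod_unfold)
      also have "\<dots> \<le> card (D p r) + card ((\<lambda>a. (a, a)) ` B)" by (rule card_Un_le)
      also have "\<dots> \<le> card (D p r) + card B" using card_image_le[OF finB] by simp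
      finally show ?thesis by (simp add: n_def)
    qed
    have num_rootsRt: "real (card (Rt p)) = real (num_roots_mod f p)" for p by (simp add: Rt_def num_roots_mod_def)
    have "(\<Sum>p\<in>P. ln (real_of_int p) * (real (num_roots_mod f p) * (n\<^sup>2 / real_of_int p - n)))
        \<le> (\<Sum>p\<in>P. ln (real_of_int p) * (\<Sum>r\<in>Rt p. real (card (D p r))))"
    proof (intro sum_mono mult_left_mono)
      fix p assume p: "p \<in> P"
      have "(\<Sum>r\<in>Rt p. n\<^sup>2 / real_of_int p - n) \<le> (\<Sum>r\<in>Rt p. real (card (D p r)))"
        using lower[OF p] by (intro sum_mono)
      then show "real (num_roots_mod f p) * (n\<^sup>2 / real_of_int p - n) \<le> (\<Sum>r\<in>Rt p. real (card (D p r)))"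
        by (simp add: num_rootsRt)
      show "ln (real_of_int p) \<ge> 0" using P[OF p] by simp
    qed
    also have "\<dots> = (\<Sum>(a, b)\<in>W. \<Sum>p\<in>P. real (card {r\<in>Rt p. p dvd poly (a - b) r}) * ln (real_of_int p))"
      by (rule swap[symmetric])
    also have "\<dots> \<le> (\<Sum>(a, b)\<in>W. real d * ln (real A) + L)"
      using upper by (intro sum_mono) auto
    also have "\<dots> = real (card W) * (real d * ln (real A) + L)" by simp
    also have "\<dots> \<le> n\<^sup>2 * (real d * ln (real A) + L)"
      using cW L0 A by (intro mult_right_mono) auto
    finally have main: "(\<Sum>p\<in>P. ln (real_of_int p) * (real (num_roots_mod f p) * (n\<^sup>2 / real_of_int p - n)))
        \<le> n\<^sup>2 * (real d * ln (real A) + L)" .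
    define S where "S = (\<Sum>p\<in>P. real (num_roots_mod f p) * ln (real_of_int p) / real_of_int p)"
    have "(\<Sum>p\<in>P. ln (real_of_int p) * (real (num_roots_mod f p) * (n\<^sup>2 / real_of_int p - n)))
        = n\<^sup>2 * S - n * (\<Sum>p\<in>P. real (num_roots_mod f p) * ln (real_of_int p))"
      unfolding S_def sum_distrib_left sum_subtractf[symmetric]
      by (intro sum.cong) (auto simp: algebra_simps)
    \<comment> \<open>The diagonal correction is \<open>n\<close> times this sum. As the primes stop
      at n = A^d, Chebyshev's bound makes it O(n^2), which disappears into the constant after
      division by n^2.\<close>
    moreover have "(\<Sum>p\<in>P. real (num_roots_mod f p) * ln (real_of_int p)) \<le> real d * (ln 4 * n)"
    proof -
      have "(\<Sum>p\<in>P. real (num_roots_mod f p) * ln (real_of_int p)) \<le> (\<Sum>p\<in>P. real d * ln (real_of_int p))"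
        using num_roots_mod_le_degree[OF assms(1)] P assms(3) by (intro sum_mono mult_right_mono) (auto dest: P)
      also have "\<dots> \<le> real d * (ln 4 * n)"
        unfolding sum_distrib_left[symmetric] n(1) P_def by (intro mult_left_mono chebyshev_theta) auto
      finally show ?thesis .
    qed
    then have "n * (\<Sum>p\<in>P. real (num_roots_mod f p) * ln (real_of_int p)) \<le> n * (real d * (ln 4 * n))"
      using n(2) by (intro mult_left_mono) auto
    ultimately have "n\<^sup>2 * S \<le> n\<^sup>2 * (real d * ln (real A) + L + real d * ln 4)"
      using main by (simp add: algebra_simps power2_eq_square)
    then have "S \<le> real d * ln (real A) + L + real d * ln 4" using n(2) by simp
    then show "(\<Sum>p | prime p \<and> p \<le> int (A ^ d). real (num_roots_mod f p) * ln (real_of_int p) / real_of_int p)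
        \<le> real d * ln (real A) + (L + real d * ln 4)"
      by (simp add: S_def P_def)
  qed
qed

text \<open>Passes from the cutoffs A^d to arbitrary \<open>x\<close>: for the least
  \<open>A\<close> with x \<le> A^d, either A = 1 or A \<le> 2(A - 1), so A^d \<le> 2^d x and only a
  constant is lost.\<close>

lemma mertens_upper:
  assumes "lead_coeff f = 1" "irreducible f" "degree f \<ge> 1"
  shows "\<exists>C. \<forall>x\<ge>1. (\<Sum>p | prime p \<and> p \<le> int x. real (num_roots_mod f p) * ln (real_of_int p) / real_of_int p)
    \<le> ln (real x) + C"
proof -
  define d where "d = degree f"
  obtain C where C: "\<And>A. A \<ge> 1 \<Longrightarrow>
      (\<Sum>p | prime p \<and> p \<le> int (A ^ d). real (num_roots_mod f p) * ln (real_of_int p) / real_of_int p)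
      \<le> real d * ln (real A) + C"
    using mertens_poly_box[OF assms(1,2) d_def[symmetric]] assms(3) d_def by blast
  show ?thesis
  proof (intro exI[of _ "real d * ln 2 + C"] allI impI)
    fix x :: nat assume x: "x \<ge> 1"
    define A where "A = (LEAST A. x \<le> A ^ d)"
    have "x ^ 1 \<le> x ^ d" using x assms(3) d_def by (intro power_increasing) auto
    then have "x \<le> x ^ d" by simp
    then have xA: "x \<le> A ^ d" unfolding A_def by (rule LeastI)
    have A1: "A \<ge> 1" using xA x assms(3) d_def by (cases A) (auto simp: power_0_left split: if_splits)
    have "real A ^ d \<le> 2 ^ d * real x"
    proof (cases "A = 1")
      case True
      then show ?thesis using mult_mono[of 1 "2 ^ d" 1 "real x"] x by simp
    next
      case False
      have "\<not> x \<le> (A - 1) ^ d" using A1 not_less_Least[of "A - 1" "\<lambda>A. x \<le> A ^ d"] unfolding A_def[symmetric] by simp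
      then have "real ((A - 1) ^ d) \<le> real x" by (intro of_nat_mono) auto
      have "real A ^ d \<le> (2 * real (A - 1)) ^ d" using A1 False by (intro power_mono) auto
      also have "\<dots> = 2 ^ d * real ((A - 1) ^ d)" by (simp add: power_mult_distrib)
      also have "\<dots> \<le> 2 ^ d * real x" using \<open>real ((A - 1) ^ d) \<le> real x\<close> by (intro mult_left_mono) auto
      finally show ?thesis .
    qed
    then have "ln (real A ^ d) \<le> ln (2 ^ d * real x)" using A1 x by (subst ln_le_cancel_iff) auto
    then have lA: "real d * ln (real A) \<le> real d * ln 2 + ln (real x)"
      using A1 x by (simp add: ln_realpow ln_mult)
    have "(\<Sum>p | prime p \<and> p \<le> int x. real (num_roots_mod f p) * ln (real_of_int p) / real_of_int p)
        \<le> (\<Sum>p | prime p \<and> p \<le> int (A ^ d). real (num_roots_mod f p) * ln (real_of_int p) / real_of_int p)"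
    proof (rule sum_mono2)
      show "{p. prime p \<and> p \<le> int x} \<subseteq> {p. prime p \<and> p \<le> int (A ^ d)}"
        using of_nat_mono[OF xA, where 'a = int] by (auto simp del: of_nat_power)
    qed (auto dest: prime_ge_1_int)
    also have "\<dots> \<le> real d * ln (real A) + C" by (rule C[OF A1])
    finally show "(\<Sum>p | prime p \<and> p \<le> int x. real (num_roots_mod f p) * ln (real_of_int p) / real_of_int p)
        \<le> ln (real x) + (real d * ln 2 + C)" using lA by linarith
  qed
qed

section \<open>Small primes\<close>

text \<open>Within one class modulo \<open>a\<close> the elements of \<open>X\<close> are congruent
  modulo \<open>b\<close>, so division by \<open>b\<close> separates them and there are at most N/b
  + 1. It is applied with \<open>a\<close> = p^(\<delta>+1) and \<open>b\<close> =
  p^(k-\<delta>).\<close>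

lemma card_le_residue_classes:
  fixes X :: "nat set" and a b :: int
  assumes "X \<subseteq> {1..N}" "b > 0"
    and "\<And>m n. m \<in> X \<Longrightarrow> n \<in> X \<Longrightarrow> int m mod a = int n mod a \<Longrightarrow> b dvd int m - int n"
  shows "real (card X) \<le> real (card ((\<lambda>n. int n mod a) ` X)) * (real N / real_of_int b + 1)"
proof -
  let ?I = "(\<lambda>n. int n mod a) ` X"
  have finX: "finite X" using assms(1) finite_subset by blast
  have cls: "real (card {n\<in>X. int n mod a = c}) \<le> real N / real_of_int b + 1" for c
  proof -
    let ?X = "{n\<in>X. int n mod a = c}"
    have "inj_on (\<lambda>n. int n div b) ?X"
    proof (rule inj_onI)
      fix m n assume mn: "m \<in> ?X" "n \<in> ?X" "int m div b = int n div b"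
      then have "int m mod b = int n mod b" using assms(3)[of m n] by (simp add: mod_eq_dvd_iff)
      then have "int m = int n" using mn(3) by (metis div_mult_mod_eq)
      then show "m = n" by simp
    qed
    moreover have "(\<lambda>n. int n div b) ` ?X \<subseteq> {0..int N div b}"
      using assms(2) subsetD[OF assms(1)] by (fastforce intro!: zdiv_mono1 simp: pos_imp_zdiv_nonneg_iff)
    ultimately have "card ?X \<le> card {0..int N div b}" by (intro card_inj_on_le) auto
    moreover have "int N div b \<ge> 0" using assms(2) by (simp add: pos_imp_zdiv_nonneg_iff)
    ultimately have "real (card ?X) \<le> real_of_int (int N div b) + 1" by simp
    also have "real_of_int (int N div b) \<le> real N / real_of_int b"
      using real_of_int_div4[of "int N" b] by simp
    finally show ?thesis by simp
  qed
  have "X = (\<Union>c\<in>?I. {n\<in>X. int n mod a = c})" by auto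
  then have "card X \<le> (\<Sum>c\<in>?I. card {n\<in>X. int n mod a = c})"
    using card_UN_le[of ?I "\<lambda>c. {n\<in>X. int n mod a = c}"] finX by simp
  then have "real (card X) \<le> (\<Sum>c\<in>?I. real (card {n\<in>X. int n mod a = c}))"
    unfolding of_nat_sum[symmetric] by (rule of_nat_mono)
  also have "\<dots> \<le> (\<Sum>c\<in>?I. real N / real_of_int b + 1)" by (intro sum_mono cls)
  finally show ?thesis by simp
qed

section \<open>Separation of roots modulo prime powers\<close>

text \<open>Second-order Taylor expansion, obtained by dividing out X - n twice; the first quotient
  takes the value f'(n) at \<open>n\<close>.\<close>

lemma poly_diff_eq:
  fixes f :: "int poly"
  shows "\<exists>z. poly f m - poly f n = (m - n) * (poly (pderiv f) n + (m - n) * z)"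
proof -
  let ?g = "synthetic_div f n"
  have "pderiv f = [:-n, 1:] * pderiv ?g + ?g * pderiv [:-n, 1:] + pderiv [:poly f n:]"
    by (metis pderiv_add pderiv_mult synthetic_div_correct')
  then have "poly (pderiv f) n = poly ([:-n, 1:] * pderiv ?g + ?g * pderiv [:-n, 1:] + pderiv [:poly f n:]) n"
    by (rule arg_cong)
  then have "poly (pderiv f) n = poly ?g n" by (simp add: pderiv_pCons)
  then show ?thesis
    using poly_synthetic_div[of f m n] poly_synthetic_div[of ?g m n] by (intro exI[of _ "poly (synthetic_div ?g n) m"]) simp
qed

lemma prime_power_dvd_mult_cancel:
  fixes x y p :: int
  assumes "prime p" "p ^ k dvd x * y" "\<not> p ^ Suc \<delta> dvd y"
  shows "p ^ (k - \<delta>) dvd x"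
proof (cases "x = 0")
  case False
  have nu: "\<not> is_unit p" using assms(1) not_prime_unit by blast
  have y: "y \<noteq> 0" using assms(3) by auto
  have "k \<le> multiplicity p (x * y)" using assms(2) False y nu by (intro multiplicity_geI) auto
  also have "\<dots> = multiplicity p x + multiplicity p y"
    using assms(1) False y by (intro prime_elem_multiplicity_mult_distrib) auto
  also have "multiplicity p y < Suc \<delta>" using assms(3) y nu by (intro multiplicity_lessI) auto
  finally show ?thesis by (intro multiplicity_dvd') simp
qed simp

text \<open>A form of Hensel uniqueness that also covers the primes dividing the discriminant; for the other primes \<open>\<delta> = 0\<close>.\<close>

lemma roots_mod_prime_power_separated:
  fixes f u :: "int poly"
  assumes "f dvd pderiv f * u - [:D:]" "prime p" "\<not> p ^ Suc \<delta> dvd D"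
    and "p ^ k dvd poly f m" "p ^ k dvd poly f n" "p ^ Suc \<delta> dvd m - n"
  shows "p ^ (k - \<delta>) dvd m - n"
proof (cases "k \<le> \<delta>")
  case False
  obtain z where z: "poly f m - poly f n = (m - n) * (poly (pderiv f) n + (m - n) * z)"
    using poly_diff_eq by blast
  obtain w where w: "pderiv f * u - [:D:] = f * w" using assms(1) by (elim dvdE)
  have "poly (pderiv f * u - [:D:]) n = poly (f * w) n" by (simp only: w)
  then have D: "poly (pderiv f) n * poly u n - poly f n * poly w n = D" by (simp add: algebra_simps)
  have "p ^ Suc \<delta> dvd p ^ k" using False by (intro le_imp_power_dvd) simp
  then have fn: "p ^ Suc \<delta> dvd poly f n" using assms(5) dvd_trans by blast
  \<comment> \<open>\<open>D\<close> is a combination of f'(n) and f(n), so p^(\<delta>+1) cannot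
    divide both.\<close>
  have "\<not> p ^ Suc \<delta> dvd poly (pderiv f) n"
  proof
    assume "p ^ Suc \<delta> dvd poly (pderiv f) n"
    then have "p ^ Suc \<delta> dvd poly (pderiv f) n * poly u n - poly f n * poly w n"
      using fn by (intro dvd_diff dvd_mult2)
    then show False using assms(3) D by simp
  qed
  then have "\<not> p ^ Suc \<delta> dvd poly (pderiv f) n + (m - n) * z"
    using assms(6) dvd_add_left_iff[of "p ^ Suc \<delta>" "(m - n) * z" "poly (pderiv f) n"] by (simp del: power_Suc)
  moreover have "p ^ k dvd (m - n) * (poly (pderiv f) n + (m - n) * z)"
    using assms(4,5) z by (metis dvd_diff)
  ultimately show ?thesis using assms(2) prime_power_dvd_mult_cancel by blast
qed simp

lemma sum_inverse_power_le:
  assumes "p > (1::real)"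
  shows "(\<Sum>k=1..K. 1 / p ^ k) \<le> 1 / (p - 1)"
proof -
  have "(\<Sum>k=1..K. 1 / p ^ k) = 1 / (p - 1) - 1 / ((p - 1) * p ^ K)"
  proof (induction K)
    case (Suc K)
    define q where "q = p ^ K"
    have q: "q > 0" using assms by (simp add: q_def)
    have "1 / ((p - 1) * q) - 1 / (p * q) = 1 / ((p - 1) * (p * q))"
      using q assms by (simp add: divide_simps)
    then show ?case using Suc by (simp add: q_def)
  qed simp
  also have "\<dots> \<le> 1 / (p - 1)" using assms by simp
  finally show ?thesis .
qed

text \<open>Roots modulo p^k lie in at most \<open>R\<close> classes modulo p^(\<delta>+1), each
  contributing at most N p^\<delta>/p^k + 1. Summing over k \<le> K gives a geometric series and the
  term \<open>K\<close>.\<close>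

lemma sum_multiplicity_le:
  fixes f u :: "int poly"
  assumes "f dvd pderiv f * u - [:D:]" "prime p" "\<not> p ^ Suc \<delta> dvd D"
    and "\<And>n. n \<in> {1..N} \<Longrightarrow> poly f (int n) \<noteq> 0 \<and> multiplicity p (poly f (int n)) \<le> K"
    and "card ((\<lambda>n. int n mod p ^ Suc \<delta>) ` {n\<in>{1..N}. p dvd poly f (int n)}) \<le> R"
  shows "real (\<Sum>n=1..N. multiplicity p (poly f (int n)))
    \<le> real R * (real N * real_of_int p ^ \<delta> / (real_of_int p - 1) + real K)"
proof -
  define S where "S k = {n\<in>{1..N}. p ^ k dvd poly f (int n)}" for k
  have p: "real_of_int p > 1" using assms(2) prime_gt_1_int[of p] by simp
  have S: "real (card (S k)) \<le> real R * (real N * real_of_int p ^ \<delta> * (1 / real_of_int p ^ k) + 1)" if k: "k \<ge> 1" for k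
  proof -
    let ?I = "(\<lambda>n. int n mod p ^ Suc \<delta>) ` S k"
    have "real (card (S k)) \<le> real (card ?I) * (real N / real_of_int (p ^ (k - \<delta>)) + 1)"
    proof (rule card_le_residue_classes)
      show "p ^ (k - \<delta>) > 0" using p by simp
      fix m n assume "m \<in> S k" "n \<in> S k" "int m mod p ^ Suc \<delta> = int n mod p ^ Suc \<delta>"
      then show "p ^ (k - \<delta>) dvd int m - int n"
        by (intro roots_mod_prime_power_separated[OF assms(1,2,3)]) (auto simp: S_def mod_eq_dvd_iff)
    qed (auto simp: S_def)
    also have "\<dots> \<le> real R * (real N * real_of_int p ^ \<delta> * (1 / real_of_int p ^ k) + 1)"
    proof (rule mult_mono)
      have "p dvd x" if "p ^ k dvd x" for x
        using dvd_trans[OF dvd_power[of k p] that] k by simp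
      then have "?I \<subseteq> (\<lambda>n. int n mod p ^ Suc \<delta>) ` {n\<in>{1..N}. p dvd poly f (int n)}"
        by (intro image_mono) (auto simp: S_def)
      then have "card ?I \<le> card ((\<lambda>n. int n mod p ^ Suc \<delta>) ` {n\<in>{1..N}. p dvd poly f (int n)})"
        by (intro card_mono) auto
      then show "real (card ?I) \<le> real R" using assms(5) by linarith
      \<comment> \<open>Only an inequality holds, because \<open>k - \<delta>\<close> is truncated
        to 0 for k < \<delta>.\<close>
      have "real_of_int p ^ k \<le> real_of_int p ^ (\<delta> + (k - \<delta>))" using p by (intro power_increasing) auto
      then have "1 / real_of_int p ^ (k - \<delta>) \<le> real_of_int p ^ \<delta> / real_of_int p ^ k"
        using p by (simp add: field_simps power_add)
      then have "real N * (1 / real_of_int p ^ (k - \<delta>)) \<le> real N * (real_of_int p ^ \<delta> / real_of_int p ^ k)"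
        by (intro mult_left_mono) auto
      then show "real N / real_of_int (p ^ (k - \<delta>)) + 1 \<le> real N * real_of_int p ^ \<delta> * (1 / real_of_int p ^ k) + 1"
        by simp
    qed (use p in auto)
    finally show ?thesis .
  qed
  have "real (\<Sum>n=1..N. multiplicity p (poly f (int n))) = (\<Sum>k=1..K. real (card (S k)))"
    unfolding S_def by (subst sum_multiplicity_eq[OF _ assms(2), of _ _ K]) (use assms(4) in auto)
  also have "\<dots> \<le> (\<Sum>k=1..K. real R * (real N * real_of_int p ^ \<delta> * (1 / real_of_int p ^ k) + 1))"
    using S by (intro sum_mono) auto
  also have "\<dots> = real R * (real N * real_of_int p ^ \<delta> * (\<Sum>k=1..K. 1 / real_of_int p ^ k) + real K)"
    by (simp only: sum_distrib_left[symmetric] sum.distrib) simp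
  also have "\<dots> \<le> real R * (real N * real_of_int p ^ \<delta> * (1 / (real_of_int p - 1)) + real K)"
    using p sum_inverse_power_le[OF p, of K] by (intro mult_left_mono add_right_mono) auto
  finally show ?thesis by simp
qed

lemma abs_poly_le:
  fixes f :: "int poly"
  assumes "lead_coeff f = 1" 
  shows "\<exists>c\<ge>1. \<forall>n N. 1 \<le> n \<longrightarrow> n \<le> N \<longrightarrow> \<bar>poly f (int n)\<bar> \<le> c * int N ^ degree f"
proof (intro exI conjI allI impI)
  let ?c = "\<Sum>i\<le>degree f. \<bar>coeff f i\<bar>"
  have "\<bar>coeff f (degree f)\<bar> \<le> ?c" by (intro member_le_sum) auto
  then show "1 \<le> ?c" using assms by simp
  fix n N :: nat assume n: "1 \<le> n" "n \<le> N"
  have "\<bar>poly f (int n)\<bar> \<le> (\<Sum>i\<le>degree f. \<bar>coeff f i\<bar> * int n ^ i)"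
    unfolding poly_altdef by (rule order_trans[OF sum_abs]) (simp add: abs_mult)
  also have "\<dots> \<le> (\<Sum>i\<le>degree f. \<bar>coeff f i\<bar> * int N ^ degree f)"
  proof (intro sum_mono mult_left_mono)
    fix i assume "i \<in> {..degree f}"
    then have "int N ^ i \<le> int N ^ degree f" using n by (intro power_increasing) auto
    moreover have "int n ^ i \<le> int N ^ i" using n by (intro power_mono) auto
    ultimately show "int n ^ i \<le> int N ^ degree f" by linarith
  qed auto
  finally show "\<bar>poly f (int n)\<bar> \<le> ?c * int N ^ degree f" by (simp add: sum_distrib_right)
qed

text \<open>The prime power dividing f(n) is at most |f(n)| \<le> c N^d; since N \<ge> 2, the
  constant ln c is absorbed into a multiple of ln N.\<close>

lemma multiplicity_ln_le:
  fixes f :: "int poly"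
  assumes "lead_coeff f = 1" "\<And>n. poly f (int n) \<noteq> 0"
  shows "\<exists>L\<ge>0. \<forall>N\<ge>2. \<forall>n\<in>{1..N}. \<forall>p. prime p \<longrightarrow>
    real (multiplicity p (poly f (int n))) * ln (real_of_int p) \<le> L * ln (real N)"
proof -
  obtain c where c: "c \<ge> 1" "\<And>n N. 1 \<le> n \<Longrightarrow> n \<le> N \<Longrightarrow> \<bar>poly f (int n)\<bar> \<le> c * int N ^ degree f"
    using abs_poly_le[OF assms(1)] by blast
  define L where "L = ln (real_of_int c) / ln 2 + real (degree f)"
  have L0: "L \<ge> 0" unfolding L_def using c(1) by simp
  have "real (multiplicity p (poly f (int n))) * ln (real_of_int p) \<le> L * ln (real N)"
    if N: "N \<ge> 2" and n: "n \<in> {1..N}" and p: "prime p" for N n p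
  proof -
    let ?m = "multiplicity p (poly f (int n))"
    have p0: "p > 0" using p prime_gt_0_int by blast
    have "p ^ ?m dvd poly f (int n)" by (rule multiplicity_dvd)
    then have "\<bar>p ^ ?m\<bar> \<le> \<bar>poly f (int n)\<bar>" using assms(2) by (intro dvd_imp_le_int)
    also have "\<dots> \<le> c * int N ^ degree f" using n by (intro c(2)) auto
    finally have "p ^ ?m \<le> c * int N ^ degree f" using p0 by simp
    then have "real_of_int (p ^ ?m) \<le> real_of_int (c * int N ^ degree f)" by linarith
    then have "ln (real_of_int p ^ ?m) \<le> ln (real_of_int c * real N ^ degree f)"
      using p0 c(1) N by (subst ln_le_cancel_iff) auto
    then have "real ?m * ln (real_of_int p) \<le> ln (real_of_int c) + real (degree f) * ln (real N)"
      using p0 c(1) N by (simp add: ln_realpow ln_mult)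
    moreover have "ln (real_of_int c) / ln 2 * ln 2 \<le> ln (real_of_int c) / ln 2 * ln (real N)"
      using N c(1) by (intro mult_left_mono) auto
    ultimately show ?thesis by (simp add: L_def algebra_simps)
  qed
  then show ?thesis using L0 by blast
qed

text \<open>From ln p \<le> 2 sqrt p the sum is dominated by the convergent series of 2
  n^(-3/2).\<close>

lemma sum_ln_primes_over_squares_le:
  "\<exists>C. \<forall>x. (\<Sum>p | prime p \<and> p \<le> int x. ln (real_of_int p) / (real_of_int p)\<^sup>2) \<le> C"
proof -
  let ?g = "\<lambda>n. 2 * (real n powr (-(3/2)))"
  have sm: "summable ?g" by (intro summable_mult) (simp add: summable_real_powr_iff)
  have "(\<Sum>p | prime p \<and> p \<le> int x. ln (real_of_int p) / (real_of_int p)\<^sup>2) \<le> suminf ?g" for x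
  proof -
    have "(\<Sum>p | prime p \<and> p \<le> int x. ln (real_of_int p) / (real_of_int p)\<^sup>2)
        = (\<Sum>p | prime p \<and> p \<le> x. ln (real p) / (real p)\<^sup>2)"
      unfolding int_primes_eq_image by (subst sum.reindex) auto
    also have "\<dots> \<le> (\<Sum>p | prime p \<and> p \<le> x. ?g p)"
    proof (rule sum_mono)
      fix p assume "p \<in> {p. prime p \<and> p \<le> x}"
      then have p: "real p > 0" by (auto simp: prime_gt_0_nat)
      have "ln (real p) = 2 * ln (sqrt (real p))" using p by (simp add: ln_sqrt)
      also have "\<dots> \<le> 2 * sqrt (real p)" using ln_bound[of "sqrt (real p)"] p by simp
      finally have "ln (real p) / (real p)\<^sup>2 \<le> 2 * sqrt (real p) / (real p)\<^sup>2"
        by (intro divide_right_mono) auto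
      also have "\<dots> = 2 * (real p powr (1/2) / real p powr 2)"
        using p by (simp add: powr_half_sqrt)
      also have "\<dots> = 2 * real p powr (1/2 - 2)" by (simp only: powr_diff)
      finally show "ln (real p) / (real p)\<^sup>2 \<le> ?g p" by simp
    qed
    also have "\<dots> \<le> suminf ?g" by (intro sum_le_suminf sm) auto
    finally show ?thesis .
  qed
  then show ?thesis by blast
qed

text \<open>The case \<delta> = 0, where the classes are the roots modulo \<open>p\<close>.
  Splitting 1/(p-1) \<le> 1/p + 2/p^2 keeps coefficient 1 on the Mertens term and leaves a
  convergent error.\<close>

lemma good_prime_sum_le:
  fixes f u :: "int poly"
  assumes "lead_coeff f = 1" "f dvd pderiv f * u - [:D:]" "prime p" "\<not> p dvd D"
    and "\<And>n. poly f (int n) \<noteq> 0"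
    and "\<And>n. n \<in> {1..N} \<Longrightarrow> real (multiplicity p (poly f (int n))) * ln (real_of_int p) \<le> T" "T \<ge> 0"
  shows "real (\<Sum>n=1..N. multiplicity p (poly f (int n))) * ln (real_of_int p)
    \<le> real N * (real (num_roots_mod f p) * ln (real_of_int p) / real_of_int p)
      + 2 * real (degree f) * real N * (ln (real_of_int p) / (real_of_int p)\<^sup>2) + real (degree f) * T"
proof -
  let ?q = "real_of_int p"
  have q: "?q \<ge> 2" using prime_ge_2_int[OF assms(3)] by simp
  then have lq: "ln ?q > 0" by simp
  define K where "K = nat \<lfloor>T / ln ?q\<rfloor>"
  have "real K \<le> T / ln ?q" unfolding K_def using assms(7) lq by simp
  then have K: "real K * ln ?q \<le> T" using lq by (simp add: le_divide_eq)
  have mK: "multiplicity p (poly f (int n)) \<le> K" if "n \<in> {1..N}" for n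
    unfolding K_def using assms(6)[OF that] lq by (simp add: le_nat_floor le_divide_eq)
  have "real (\<Sum>n=1..N. multiplicity p (poly f (int n)))
      \<le> real (num_roots_mod f p) * (real N * ?q ^ 0 / (?q - 1) + real K)"
  proof (rule sum_multiplicity_le[OF assms(2,3)])
    have "(\<lambda>n. int n mod p ^ Suc 0) ` {n\<in>{1..N}. p dvd poly f (int n)} \<subseteq> {r\<in>{0..<p}. p dvd poly f r}"
    proof
      fix r assume "r \<in> (\<lambda>n. int n mod p ^ Suc 0) ` {n\<in>{1..N}. p dvd poly f (int n)}"
      then obtain n where n: "r = int n mod p" "p dvd poly f (int n)" by auto
      have "p dvd int n - r" unfolding n(1) by (simp add: minus_mod_eq_mult_div)
      then have "p dvd poly f (int n) - poly f r" using poly_diff_eq[of f "int n" r] by (metis dvd_mult2)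
      then have "p dvd poly f r" using n(2) by (metis dvd_diff diff_diff_eq2 add_diff_cancel_left')
      then show "r \<in> {r\<in>{0..<p}. p dvd poly f r}" using n(1) q by simp
    qed
    then show "card ((\<lambda>n. int n mod p ^ Suc 0) ` {n\<in>{1..N}. p dvd poly f (int n)}) \<le> num_roots_mod f p"
      unfolding num_roots_mod_def by (intro card_mono) (auto intro: finite_subset[of _ "{0..<p}"])
  qed (use assms(4,5) mK in auto)
  then have "real (\<Sum>n=1..N. multiplicity p (poly f (int n))) * ln ?q
      \<le> (real (num_roots_mod f p) * (real N * ?q ^ 0 / (?q - 1) + real K)) * ln ?q"
    using lq by (intro mult_right_mono) auto
  also have "\<dots> = real (num_roots_mod f p) * (real N * ln ?q) * (1 / (?q - 1)) + real (num_roots_mod f p) * (real K * ln ?q)"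
    by (simp add: algebra_simps)
  also have "\<dots> \<le> real (num_roots_mod f p) * (real N * ln ?q) * (1 / ?q + 2 / ?q\<^sup>2) + real (degree f) * T"
  proof (intro add_mono mult_left_mono mult_mono)
    have "?q * ?q \<le> (?q + 2) * (?q - 1)" using q by (simp add: algebra_simps)
    then show "1 / (?q - 1) \<le> 1 / ?q + 2 / ?q\<^sup>2" using q by (simp add: divide_simps power2_eq_square)
    show "real (num_roots_mod f p) \<le> real (degree f)" using num_roots_mod_le_degree[OF assms(1,3)] by simp
  qed (use K lq in auto)
  also have "\<dots> = real N * (real (num_roots_mod f p) * ln ?q / ?q) + 2 * real (num_roots_mod f p) * real N * (ln ?q / ?q\<^sup>2) + real (degree f) * T"
    by (simp add: algebra_simps)
  also have "\<dots> \<le> real N * (real (num_roots_mod f p) * ln ?q / ?q) + 2 * real (degree f) * real N * (ln ?q / ?q\<^sup>2) + real (degree f) * T"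
    using num_roots_mod_le_degree[OF assms(1,3)] lq by (intro add_mono mult_right_mono mult_left_mono) auto
  finally show ?thesis .
qed

text \<open>Intended for the finitely many primes dividing \<open>D\<close>: the constant may depend
  on \<open>p\<close>, so counting all classes modulo p^(\<delta>+1) suffices.\<close>

lemma bad_prime_sum_le:
  fixes f u :: "int poly"
  assumes "f dvd pderiv f * u - [:D:]" "prime p" "D \<noteq> 0"
    and "\<And>n. poly f (int n) \<noteq> 0" "L \<ge> 0"
    and "\<And>N n. N \<ge> 2 \<Longrightarrow> n \<in> {1..N} \<Longrightarrow> real (multiplicity p (poly f (int n))) * ln (real_of_int p) \<le> L * ln (real N)"
  shows "\<exists>C\<ge>0. \<forall>N\<ge>2. real (\<Sum>n=1..N. multiplicity p (poly f (int n))) * ln (real_of_int p) \<le> C * real N"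
proof -
  let ?q = "real_of_int p"
  define \<delta> where "\<delta> = multiplicity p D"
  have q: "?q \<ge> 2" using prime_ge_2_int[OF assms(2)] by simp
  then have lq: "ln ?q > 0" by simp
  have nd: "\<not> p ^ Suc \<delta> dvd D"
    using assms(2,3) not_prime_unit[of p] by (auto simp: \<delta>_def power_dvd_iff_le_multiplicity simp del: power_Suc)
  define R where "R = nat (p ^ Suc \<delta>)"
  define C where "C = real R * (?q ^ \<delta> * ln ?q + L)"
  have "real (\<Sum>n=1..N. multiplicity p (poly f (int n))) * ln ?q \<le> C * real N" if N: "N \<ge> 2" for N
  proof -
    define K where "K = nat \<lfloor>L * ln (real N) / ln ?q\<rfloor>"
    have "real K \<le> L * ln (real N) / ln ?q" unfolding K_def using assms(5) lq N by simp
    then have "real K * ln ?q \<le> L * ln (real N)" using lq by (simp add: le_divide_eq)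
    also have "\<dots> \<le> L * real N" using ln_bound[of "real N"] N assms(5) by (intro mult_left_mono) auto
    finally have K: "real K * ln ?q \<le> L * real N" .
    have mK: "multiplicity p (poly f (int n)) \<le> K" if "n \<in> {1..N}" for n
      unfolding K_def using assms(6)[OF N that] lq by (simp add: le_nat_floor le_divide_eq)
    have "real (\<Sum>n=1..N. multiplicity p (poly f (int n))) \<le> real R * (real N * ?q ^ \<delta> / (?q - 1) + real K)"
    proof (rule sum_multiplicity_le[OF assms(1,2) nd])
      have pp: "p ^ Suc \<delta> > 0" using q by simp
      have "(\<lambda>n. int n mod p ^ Suc \<delta>) ` {n\<in>{1..N}. p dvd poly f (int n)} \<subseteq> {0..<p ^ Suc \<delta>}"
        using pp by (auto simp del: power_Suc)
      then have "card ((\<lambda>n. int n mod p ^ Suc \<delta>) ` {n\<in>{1..N}. p dvd poly f (int n)}) \<le> card {0..<p ^ Suc \<delta>}"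
        by (intro card_mono) auto
      then show "card ((\<lambda>n. int n mod p ^ Suc \<delta>) ` {n\<in>{1..N}. p dvd poly f (int n)}) \<le> R"
        by (simp add: R_def)
    qed (use assms(4) mK in auto)
    also have "\<dots> \<le> real R * (real N * ?q ^ \<delta> + real K)"
    proof (intro mult_left_mono add_right_mono)
      have "real N * ?q ^ \<delta> * 1 \<le> real N * ?q ^ \<delta> * (?q - 1)" using q by (intro mult_left_mono) auto
      then show "real N * ?q ^ \<delta> / (?q - 1) \<le> real N * ?q ^ \<delta>" using q by (simp add: divide_le_eq)
    qed auto
    finally have "real (\<Sum>n=1..N. multiplicity p (poly f (int n))) * ln ?q
        \<le> (real R * (real N * ?q ^ \<delta> + real K)) * ln ?q" using lq by (intro mult_right_mono) auto
    also have "\<dots> = real R * (real N * ?q ^ \<delta> * ln ?q + real K * ln ?q)" by (simp add: algebra_simps)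
    also have "\<dots> \<le> real R * (real N * ?q ^ \<delta> * ln ?q + L * real N)" using K by (intro mult_left_mono) auto
    also have "\<dots> = C * real N" by (simp add: C_def algebra_simps)
    finally show ?thesis .
  qed
  moreover have "C \<ge> 0" unfolding C_def using lq q assms(5) by simp
  ultimately show ?thesis by blast
qed

lemma small_primes_sum_le:
  fixes f :: "int poly"
  assumes "lead_coeff f = 1" "irreducible f" "degree f \<ge> 1" "\<And>n. poly f (int n) \<noteq> 0" "B \<ge> 1"
  shows "\<exists>C. \<forall>N\<ge>2. (\<Sum>p | prime p \<and> p \<le> int (B * N).
      real (\<Sum>n=1..N. multiplicity p (poly f (int n))) * ln (real_of_int p)) \<le> real N * ln (real N) + C * real N"
proof -
  let ?d = "real (degree f)"
  define V where "V N p = real (\<Sum>n=1..N. multiplicity p (poly f (int n))) * ln (real_of_int p)" for N p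
  \<comment> \<open>Up to sign, the discriminant of \<open>f\<close>.\<close>
  define D where "D = norm_mod f (pderiv f)"
  have "pderiv f \<noteq> 0" "degree (pderiv f) < degree f"
    using assms(3) by (auto simp: pderiv_eq_0_iff degree_pderiv)
  then have D0: "D \<noteq> 0" unfolding D_def using norm_mod_nonzero[OF assms(1-3)] by blast
  obtain u where u: "f dvd pderiv f * u - [:D:]"
    using norm_mod_combination[OF assms(1,3)] D_def by blast
  obtain L where L: "L \<ge> 0" "\<And>N n p. N \<ge> 2 \<Longrightarrow> n \<in> {1..N} \<Longrightarrow> prime p \<Longrightarrow>
      real (multiplicity p (poly f (int n))) * ln (real_of_int p) \<le> L * ln (real N)"
    using multiplicity_ln_le[OF assms(1,4)] by blast
  obtain C1 where C1: "\<And>x. x \<ge> 1 \<Longrightarrow>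
      (\<Sum>p | prime p \<and> p \<le> int x. real (num_roots_mod f p) * ln (real_of_int p) / real_of_int p) \<le> ln (real x) + C1"
    using mertens_upper[OF assms(1-3)] by blast
  obtain C2 where C2: "\<And>x. (\<Sum>p | prime p \<and> p \<le> int x. ln (real_of_int p) / (real_of_int p)\<^sup>2) \<le> C2"
    using sum_ln_primes_over_squares_le by blast
  have "\<forall>p\<in>prime_factors D. \<exists>C\<ge>0. \<forall>N\<ge>2. V N p \<le> C * real N"
    unfolding V_def using L(2) by (intro ballI bad_prime_sum_le[OF u _ D0 assms(4) L(1)]) auto
  then obtain c where c: "\<And>p. p \<in> prime_factors D \<Longrightarrow> c p \<ge> 0"
      "\<And>p N. p \<in> prime_factors D \<Longrightarrow> N \<ge> 2 \<Longrightarrow> V N p \<le> c p * real N" by metis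
  define C3 where "C3 = (\<Sum>p\<in>prime_factors D. c p)"
  have "(\<Sum>p | prime p \<and> p \<le> int (B * N). V N p) \<le> real N * ln (real N)
      + (C3 + ln (real B) + C1 + 2 * ?d * C2 + ?d * L * ((2 * ln 4 + 2) * real B)) * real N" if N: "N \<ge> 2" for N
  proof -
    define P where "P = {p. prime p \<and> p \<le> int (B * N)}"
    define X where "X p = real N * (real (num_roots_mod f p) * ln (real_of_int p) / real_of_int p)
      + 2 * ?d * real N * (ln (real_of_int p) / (real_of_int p)\<^sup>2) + ?d * (L * ln (real N))" for p
    have finP: "finite P" unfolding P_def by simp
    have BN: "B * N \<ge> 1" using assms(5) N by simp
    have lnN: "ln (real N) \<ge> 0" using N by simp
    have X0: "X p \<ge> 0" if "p \<in> P" for p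
    proof -
      have "p \<ge> 1" using that prime_ge_1_int unfolding P_def by blast
      then show ?thesis unfolding X_def using L(1) lnN by simp
    qed
    have "(\<Sum>p\<in>P. V N p) = (\<Sum>p\<in>P \<inter> prime_factors D. V N p) + (\<Sum>p\<in>P - prime_factors D. V N p)"
      by (rule sum.Int_Diff[OF finP])
    also have "(\<Sum>p\<in>P \<inter> prime_factors D. V N p) \<le> (\<Sum>p\<in>P \<inter> prime_factors D. c p * real N)"
      using c(2) N by (intro sum_mono) auto
    also have "\<dots> \<le> (\<Sum>p\<in>prime_factors D. c p * real N)" using c(1) by (intro sum_mono2) auto
    also have "\<dots> = C3 * real N" by (simp add: C3_def sum_distrib_right)
    also have "(\<Sum>p\<in>P - prime_factors D. V N p) \<le> (\<Sum>p\<in>P - prime_factors D. X p)"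
    proof (rule sum_mono)
      fix p assume "p \<in> P - prime_factors D"
      then have p: "prime p" "\<not> p dvd D" using D0 unfolding P_def by (auto simp: prime_factors_dvd)
      show "V N p \<le> X p" unfolding V_def X_def
        using L(2)[OF N _ p(1)] L(1) lnN by (intro good_prime_sum_le[OF assms(1) u p assms(4)]) auto
    qed
    also have "\<dots> \<le> (\<Sum>p\<in>P. X p)" using finP X0 by (intro sum_mono2) auto
    also have "\<dots> = real N * (\<Sum>p\<in>P. real (num_roots_mod f p) * ln (real_of_int p) / real_of_int p)
        + 2 * ?d * real N * (\<Sum>p\<in>P. ln (real_of_int p) / (real_of_int p)\<^sup>2)
        + ?d * L * (real (card P) * ln (real N))"
      unfolding X_def by (simp only: sum.distrib sum_distrib_left[symmetric]) simp
    also have "\<dots> \<le> real N * (ln (real (B * N)) + C1) + 2 * ?d * real N * C2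
        + ?d * L * ((2 * ln 4 + 2) * real (B * N))"
    proof (intro add_mono mult_left_mono)
      \<comment> \<open>The error of order ln N at each prime totals O(N), since there are only O(N
        / ln N) primes up to B N.\<close>
      have "real (card P) * ln (real N) \<le> real (card P) * ln (real (B * N))"
      proof (intro mult_left_mono)
        have "real (1 * N) \<le> real (B * N)" using assms(5) by (intro of_nat_mono mult_le_mono1)
        then have "real N \<le> real (B * N)" by simp
        then show "ln (real N) \<le> ln (real (B * N))" using N by (subst ln_le_cancel_iff) auto
      qed auto
      also have "\<dots> \<le> (2 * ln 4 + 2) * real (B * N)" unfolding P_def by (rule chebyshev_pi[OF BN])
      finally show "real (card P) * ln (real N) \<le> (2 * ln 4 + 2) * real (B * N)" .
    qed (use C1[OF BN] C2[of "B * N"] L(1) in \<open>auto simp: P_def\<close>)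
    also have "ln (real (B * N)) = ln (real B) + ln (real N)" using assms(5) N by (simp add: ln_mult)
    finally show ?thesis by (simp add: P_def algebra_simps)
  qed
  then show ?thesis unfolding V_def by blast
qed

section \<open>Lower bound for the product of the values\<close>

lemma sum_ln_ge: "real N * ln (real N) - real N \<le> (\<Sum>n=1..N. ln (real n))"
proof (induction N)
  case (Suc N)
  show ?case
  proof (cases "N = 0")
    case False
    have "ln (1 + 1 / real N) \<le> 1 / real N" by (rule ln_add_one_self_le_self) simp
    moreover have "1 + 1 / real N = real (Suc N) / real N" using False by (simp add: field_simps)
    ultimately have "ln (real (Suc N)) - ln (real N) \<le> 1 / real N" using False by (simp add: ln_div)
    then have "real N * (ln (real (Suc N)) - ln (real N)) \<le> real N * (1 / real N)" by (intro mult_left_mono) auto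
    then have "real N * ln (real (Suc N)) \<le> real N * ln (real N) + 1" using False by (simp add: algebra_simps)
    then show ?thesis using Suc by (simp add: algebra_simps)
  qed simp
qed simp

text \<open>|f(n)| \<ge> (n/(t+1))^d for all n \<ge> 1: beyond \<open>t\<close> the shifted
  polynomial has nonnegative coefficients, so f(n) \<ge> (n-t)^d with n - t \<ge> n/(t+1); up to
  \<open>t\<close> a nonzero integer is at least 1 in absolute value. A weak Stirling bound then
  sums the logarithms.\<close>

lemma sum_ln_abs_poly_ge:
  fixes f :: "int poly"
  assumes "lead_coeff f = 1" "\<And>n. poly f (int n) \<noteq> 0"
  shows "\<exists>C. \<forall>N. (\<Sum>n=1..N. ln (real_of_int \<bar>poly f (int n)\<bar>)) \<ge> real (degree f) * real N * ln (real N) - C * real N"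
proof -
  let ?d = "degree f"
  obtain t0 where t0: "\<And>t i. t \<ge> t0 \<Longrightarrow> coeff (pcompose f [:t, 1:]) i \<ge> 0"
    using shift_nonneg_coeffs[of f] assms(1) by auto
  define t where "t = nat t0"
  define g where "g = pcompose f [:int t, 1:]"
  have g0: "coeff g i \<ge> 0" for i unfolding g_def t_def by (rule t0) auto
  have dg: "degree g = ?d" unfolding g_def by (simp add: degree_pcompose)
  have lg: "lead_coeff g = 1" unfolding g_def using assms(1) by (subst lead_coeff_comp) auto
  have lower: "(real n / real (t + 1)) ^ ?d \<le> real_of_int \<bar>poly f (int n)\<bar>" if n: "n \<ge> 1" for n
  proof (cases "n > t")
    case True
    have "coeff g ?d * (int n - int t) ^ ?d \<le> poly g (int n - int t)"
      unfolding poly_altdef dg using g0 True by (intro member_le_sum[where f = "\<lambda>i. coeff g i * (int n - int t) ^ i"]) auto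
    then have "(int n - int t) ^ ?d \<le> \<bar>poly f (int n)\<bar>" using lg dg by (simp add: g_def poly_pcompose)
    then have "real_of_int ((int n - int t) ^ ?d) \<le> real_of_int \<bar>poly f (int n)\<bar>" by (simp only: of_int_le_iff)
    moreover have "real n / real (t + 1) \<le> real n - real t"
    proof -
      have "real t * 1 \<le> real t * (real n - real t)" using True by (intro mult_left_mono) auto
      then have "real n \<le> (real n - real t) * real (t + 1)" by (simp add: algebra_simps)
      then show ?thesis by (subst divide_le_eq) simp
    qed
    then have "(real n / real (t + 1)) ^ ?d \<le> (real n - real t) ^ ?d" by (intro power_mono) auto
    ultimately show ?thesis by simp
  next
    case False
    then have "(real n / real (t + 1)) ^ ?d \<le> 1" by (intro power_le_one) auto
    also have "1 \<le> real_of_int \<bar>poly f (int n)\<bar>" using assms(2)[of n] by linarith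
    finally show ?thesis .
  qed
  have "real ?d * real N * ln (real N) - real ?d * (1 + ln (real (t + 1))) * real N
      \<le> (\<Sum>n=1..N. ln (real_of_int \<bar>poly f (int n)\<bar>))" for N
  proof -
    have "real ?d * (real N * ln (real N) - real N) - real ?d * ln (real (t + 1)) * real N
        \<le> real ?d * (\<Sum>n=1..N. ln (real n)) - real ?d * ln (real (t + 1)) * real N"
      using sum_ln_ge[of N] by (intro diff_right_mono mult_left_mono) auto
    also have "\<dots> = (\<Sum>n=1..N. real ?d * (ln (real n) - ln (real (t + 1))))"
      by (simp add: sum_subtractf sum_distrib_left algebra_simps)
    also have "\<dots> \<le> (\<Sum>n=1..N. ln (real_of_int \<bar>poly f (int n)\<bar>))"
    proof (rule sum_mono)
      fix n assume "n \<in> {1..N}"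
      then have n: "n \<ge> 1" by simp
      have "real ?d * (ln (real n) - ln (real (t + 1))) = ln ((real n / real (t + 1)) ^ ?d)"
        using n by (simp add: ln_realpow ln_div)
      also have "\<dots> \<le> ln (real_of_int \<bar>poly f (int n)\<bar>)"
        using lower[OF n] n assms(2)[of n] by (subst ln_le_cancel_iff) auto
      finally show "real ?d * (ln (real n) - ln (real (t + 1))) \<le> ln (real_of_int \<bar>poly f (int n)\<bar>)" .
    qed
    finally show ?thesis by (simp add: algebra_simps)
  qed
  then show ?thesis by blast
qed

section \<open>Factorization of the values and conclusion\<close>

lemma irreducible_no_int_roots:
  fixes f :: "int poly"
  assumes "irreducible f" "degree f \<ge> 2"
  shows "poly f x \<noteq> 0"
proof
  assume "poly f x = 0"
  then obtain q where q: "f = [:- x, 1:] * q" by (auto simp: poly_eq_0_iff_dvd elim: dvdE)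
  then have "is_unit [:- x, 1:] \<or> is_unit q" using assms(1) irreducibleD by blast
  then have "degree q = 0" by (auto simp: is_unit_poly_iff)
  moreover have "q \<noteq> 0" using q assms(1) by auto
  ultimately have "degree f \<le> 1" unfolding q by (subst degree_mult_eq) auto
  then show False using assms(2) by simp
qed

lemma prime_factors_Lcm:
  fixes S :: "int set"
  assumes "finite S" "0 \<notin> S"
  shows "prime_factors (Lcm S) = (\<Union>x\<in>S. prime_factors x)"
proof -
  have nz: "Lcm S \<noteq> 0" using assms by (simp add: Lcm_0_iff)
  show ?thesis
  proof (intro equalityI subsetI)
    fix p assume "p \<in> prime_factors (Lcm S)"
    then have p: "prime p" "p dvd Lcm S" by (auto simp: prime_factors_dvd)
    have "Lcm S dvd \<Prod>S" using assms(1) by (intro Lcm_least) auto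
    then have "p dvd \<Prod>S" using p(2) dvd_trans by blast
    then obtain x where "x \<in> S" "p dvd x" using assms(1) p(1) by (auto simp: prime_dvd_prod_iff)
    have "x \<noteq> 0" using \<open>x \<in> S\<close> assms(2) by blast
    then have "p \<in> prime_factors x" using p(1) \<open>p dvd x\<close> by (simp add: prime_factors_dvd)
    then show "p \<in> (\<Union>x\<in>S. prime_factors x)" using \<open>x \<in> S\<close> by blast
  next
    fix p assume "p \<in> (\<Union>x\<in>S. prime_factors x)"
    then show "p \<in> prime_factors (Lcm S)" using nz by (auto simp: prime_factors_dvd intro: dvd_trans)
  qed
qed

lemma ln_abs_eq_sum_multiplicity:
  fixes x :: int
  assumes "x \<noteq> 0" "finite P" "\<And>p. p \<in> P \<Longrightarrow> prime p" "prime_factors x \<subseteq> P"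
  shows "ln (real_of_int \<bar>x\<bar>) = (\<Sum>p\<in>P. real (multiplicity p x) * ln (real_of_int p))"
proof -
  have pos: "p > 0" if "p \<in> P" for p using assms(3)[OF that] prime_gt_0_int by blast
  have "\<bar>x\<bar> = (\<Prod>p\<in>prime_factors x. p ^ multiplicity p x)"
    using prod_prime_factors[OF assms(1)] by simp
  also have "\<dots> = (\<Prod>p\<in>P. p ^ multiplicity p x)"
    using assms by (intro prod.mono_neutral_left) (auto simp: prime_factors_multiplicity)
  finally have "real_of_int \<bar>x\<bar> = (\<Prod>p\<in>P. real_of_int p ^ multiplicity p x)" by simp
  then show ?thesis using pos assms(2) by (simp only:) (subst ln_prod, auto simp: ln_realpow)
qed

theorem theorem1p3:
  fixes f :: "int poly" and d :: nat
  assumes "lead_coeff f = 1"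
    and "irreducible f"
    and "degree f = d"
    and "d \<ge> 2"
    and "even_poly f"
  shows "\<exists>C::real. C > 0 \<and>
    (\<forall>N::nat. N \<ge> 2 \<longrightarrow>
      ln (real_of_int (ell f N)) \<ge>
        8 * (real d - 1) / (real d * (3 * real d - 2)) * real N * ln (real N) - C * real N)"
proof -
  have nr: "poly f (int n) \<noteq> 0" for n
    using irreducible_no_int_roots assms(2-4) by blast
  have d1: "degree f \<ge> 1" "d \<ge> 1" using assms(3,4) by auto
  obtain B' where B': "B' \<ge> 2" "\<And>N p. N \<ge> 1 \<Longrightarrow> prime p \<Longrightarrow> p > B' * int N \<Longrightarrow>
      8 * real (\<Sum>n=1..N. multiplicity p (poly f (int n))) \<le> real d * (3 * real d - 2)"
    using large_prime_sum_multiplicity[OF assms(1,5) nr assms(3) d1(2)] by blast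
  define B where "B = nat B'"
  have B: "B \<ge> 1" "int B = B'" using B'(1) by (auto simp: B_def)
  obtain C1 where C1: "\<And>N. N \<ge> 2 \<Longrightarrow> (\<Sum>p | prime p \<and> p \<le> int (B * N).
      real (\<Sum>n=1..N. multiplicity p (poly f (int n))) * ln (real_of_int p)) \<le> real N * ln (real N) + C1 * real N"
    using small_primes_sum_le[OF assms(1,2) d1(1) nr B(1)] by blast
  obtain C2 where C2: "\<And>N. (\<Sum>n=1..N. ln (real_of_int \<bar>poly f (int n)\<bar>)) \<ge> real d * real N * ln (real N) - C2 * real N"
    using sum_ln_abs_poly_ge[OF assms(1) nr] assms(3) by blast
  \<comment> \<open>The bound on the total multiplicity of a large prime; dividing d - 1 by it
    yields the constant of the theorem.\<close>
  define \<kappa> where "\<kappa> = real d * (3 * real d - 2) / 8"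
  have \<kappa>: "\<kappa> > 0" unfolding \<kappa>_def using assms(4) by simp
  \<comment> \<open>Absolute values and the added 1 make the constant positive whatever the signs of
    \<open>C1\<close> and \<open>C2\<close>.\<close>
  have main: "ln (real_of_int (ell f N)) \<ge> (real d - 1) / \<kappa> * real N * ln (real N) - (\<bar>C1\<bar> + \<bar>C2\<bar> + 1) / \<kappa> * real N"
    if N: "N \<ge> 2" for N
  proof -
    define P where "P = (\<Union>n\<in>{1..N}. prime_factors (poly f (int n)))"
    define V where "V p = real (\<Sum>n=1..N. multiplicity p (poly f (int n))) * ln (real_of_int p)" for p
    have finP: "finite P" unfolding P_def by simp
    have P: "prime p" if "p \<in> P" for p using that unfolding P_def by auto
    have P1: "p \<ge> 1" if "p \<in> P" for p using P[OF that] prime_ge_1_int by blast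
    have "prime_factors (Lcm ((\<lambda>n. poly f (int n)) ` {1..N})) = P"
      unfolding P_def using nr by (subst prime_factors_Lcm) auto
    then have "real_of_int (ell f N) = (\<Prod>p\<in>P. real_of_int p)" by (simp add: ell_def rad_def)
    then have ell: "ln (real_of_int (ell f N)) = (\<Sum>p\<in>P. ln (real_of_int p))"
      using finP P1 by (simp only:) (subst ln_prod, force+)
    have "(\<Sum>n=1..N. ln (real_of_int \<bar>poly f (int n)\<bar>))
        = (\<Sum>n=1..N. \<Sum>p\<in>P. real (multiplicity p (poly f (int n))) * ln (real_of_int p))"
      using nr finP P by (intro sum.cong ln_abs_eq_sum_multiplicity) (auto simp: P_def)
    also have "\<dots> = (\<Sum>p\<in>P. V p)" unfolding V_def by (subst sum.swap) (simp add: sum_distrib_right)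
    also have "\<dots> = (\<Sum>p\<in>P \<inter> {p. p \<le> int (B * N)}. V p) + (\<Sum>p\<in>P - {p. p \<le> int (B * N)}. V p)"
      by (rule sum.Int_Diff[OF finP])
    also have "(\<Sum>p\<in>P \<inter> {p. p \<le> int (B * N)}. V p) \<le> (\<Sum>p | prime p \<and> p \<le> int (B * N). V p)"
    proof (rule sum_mono2)
      fix p assume "p \<in> {p. prime p \<and> p \<le> int (B * N)} - P \<inter> {p. p \<le> int (B * N)}"
      then have "p \<ge> 1" using prime_ge_1_int by blast
      then show "0 \<le> V p" unfolding V_def by (intro mult_nonneg_nonneg of_nat_0_le_iff) auto
    qed (use P in auto)
    also have "\<dots> \<le> real N * ln (real N) + C1 * real N" unfolding V_def by (rule C1[OF N])
    also have "(\<Sum>p\<in>P - {p. p \<le> int (B * N)}. V p) \<le> (\<Sum>p\<in>P - {p. p \<le> int (B * N)}. \<kappa> * ln (real_of_int p))"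
    proof (rule sum_mono)
      fix p assume p: "p \<in> P - {p. p \<le> int (B * N)}"
      then have "8 * real (\<Sum>n=1..N. multiplicity p (poly f (int n))) \<le> real d * (3 * real d - 2)"
        using P N B(2) by (intro B'(2)) auto
      then show "V p \<le> \<kappa> * ln (real_of_int p)"
        unfolding V_def \<kappa>_def using P1[of p] p by (intro mult_right_mono) auto
    qed
    also have "\<dots> \<le> (\<Sum>p\<in>P. \<kappa> * ln (real_of_int p))"
      using finP \<kappa> P1 by (intro sum_mono2) auto
    also have "\<dots> = \<kappa> * ln (real_of_int (ell f N))" by (simp add: ell sum_distrib_left)
    finally have "real d * real N * ln (real N) - C2 * real N
        \<le> real N * ln (real N) + C1 * real N + \<kappa> * ln (real_of_int (ell f N))"
      using C2[of N] by linarith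
    moreover have "C1 * real N \<le> \<bar>C1\<bar> * real N" "C2 * real N \<le> \<bar>C2\<bar> * real N"
      by (intro mult_right_mono; simp)+
    ultimately have "(real d - 1) * real N * ln (real N) - (\<bar>C1\<bar> + \<bar>C2\<bar> + 1) * real N
        \<le> \<kappa> * ln (real_of_int (ell f N))" by (simp add: algebra_simps)
    then have "((real d - 1) * real N * ln (real N) - (\<bar>C1\<bar> + \<bar>C2\<bar> + 1) * real N) / \<kappa>
        \<le> ln (real_of_int (ell f N))" using \<kappa> by (simp add: divide_le_eq mult.commute)
    moreover have "((real d - 1) * real N * ln (real N) - (\<bar>C1\<bar> + \<bar>C2\<bar> + 1) * real N) / \<kappa>
        = (real d - 1) / \<kappa> * real N * ln (real N) - (\<bar>C1\<bar> + \<bar>C2\<bar> + 1) / \<kappa> * real N"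
      using \<kappa> by (simp add: field_simps)
    ultimately show ?thesis by simp
  qed
  have "(real d - 1) / \<kappa> = 8 * (real d - 1) / (real d * (3 * real d - 2))" by (simp add: \<kappa>_def)
  then show ?thesis using main \<kappa> by (intro exI[of _ "(\<bar>C1\<bar> + \<bar>C2\<bar> + 1) / \<kappa>"]) (auto intro!: divide_pos_pos)
qed

end
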